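(* Let $L\ge 1$ and $\varepsilon_0,\varepsilon_1,\varepsilon_2\ge 0$, and let $p\ge 0$ be an integer. Suppose that $X_{cont.}\to X_{net}\to Y_{clean}\to Y_{noisy}$ is an $(L,\varepsilon_0,\varepsilon_1,\varepsilon_2)$-model and that the persistence module $\mathbb{H}_p(X_{cont.})$ is decomposable. Let $\vartheta(t)=L(t+\varepsilon_2+\varepsilon_1)+\varepsilon_0$ and $\varphi^{-1}(t)=\frac{t-L\varepsilon_0-\varepsilon_1-\varepsilon_2}{L}$. Denote $$\mathrm{Dgm}^{(L,\varepsilon_0,\varepsilon_1,\varepsilon_2)}_p(Y_{noisy}):=\{(k,(a,b))\in \mathrm{Dgm}_p(Y_{noisy})\colon \vartheta(a)<\varphi^{-1}(b)\}.$$ Then there exists an injection $$\boxdot\colon \mathrm{Dgm}^{(L,\varepsilon_0,\varepsilon_1,\varepsilon_2)}_p(Y_{noisy})\to \mathrm{Dgm}_p(X_{cont.})$$ such that for every $(k,(a,b))\in \mathrm{Dgm}^{(L,\varepsilon_0,\varepsilon_1,\varepsilon_2)}_p(Y_{noisy})$, writing $\boxdot\big((k,(a,b))\big)=(l,(c,d))\in \mathrm{Dgm}_p(X_{cont.})$, it holds that $$(c,d)\in[\varphi^{-1}(a),\vartheta(a)]\times[\varphi^{-1}(b),\vartheta(b)].$$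
   Context: Quasi-isometries. A map $f\colon (X,d_X)\to(Y,d_Y)$ of metric spaces is an $(L,\varepsilon)$-quasi-isometric embedding ($L\ge1$, $\varepsilon\ge0$) if $\frac1L d_X(x_1,x_2)-\varepsilon\le d_Y(f(x_1),f(x_2))\le L d_X(x_1,x_2)+\varepsilon$ for all $x_1,x_2\in X$. It is an $(L,\varepsilon,\delta)$-quasi-isometry if moreover the Hausdorff distance between $f(X)$ and $Y$ in $Y$ is at most $\delta$. Model. An $(L,\varepsilon_0,\varepsilon_1,\varepsilon_2)$-model $X_{cont.}\to X_{net}\to Y_{clean}\to Y_{noisy}$ consists of metric spaces (nonempty) and maps between them such that: $X_{net}\subset X_{cont.}$ is a finite subset (with the restricted metric) and $f^{(0)}\colon X_{cont.}\to X_{net}$ is a $(1,\varepsilon_0,0)$-quasi-isometry satisfying $d_{X_{cont.}}(x,f^{(0)}(x))\le\frac12\varepsilon_0$ for all $x$; $f^{(1)}\colon X_{net}\to Y_{clean}$ is an $(L,\varepsilon_1,0)$-quasi-isometry; and $f^{(2)}\colon Y_{clean}\to Y_{noisy}$ is a $(1,\varepsilon_2,0)$-quasi-isometry (the typical case being $Y_{clean}$, $Y_{noisy}$ in a normed space and $f^{(2)}(y)=y+E$ with $\|E\|\le\frac12\varepsilon_2$). In particular $Y_{clean}$ and $Y_{noisy}$ are finite. Rips homology. For a metric space $X$, a $p$-simplex is any map $\{0,\dots,p\}\to X$, written $[x_0,\dots,x_p]$ (repetitions allowed). $\mathrm{Rips}_p(X,s)$ is the $\mathbb Z_2$-vector space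 with basis the $p$-simplices with $\mathrm{diam}\{x_0,\dots,x_p\}\le s$ (it is $0$ for $s<0$ or $p<0$), with boundary $\partial_p[x_0,\dots,x_p]=\sum_i(-1)^i[x_0,\dots,x_{i-1},x_{i+1},\dots,x_p]$. $H_p(\mathrm{Rips}(X,s))=\ker\partial_p/\mathrm{im}\,\partial_{p+1}$, and for $s\le t$, $\phi_X^{t,s}\colon H_p(\mathrm{Rips}(X,s))\to H_p(\mathrm{Rips}(X,t))$ is induced by inclusion. Persistence modules and diagrams. A persistence module is a family of vector spaces $(V^s)_{s\in\mathbb R}$ with linear maps $v^{t,s}\colon V^s\to V^t$ ($s\le t$), $v^{t,s}=v^{t,r}v^{r,s}$, $v^{t,t}=\mathrm{id}$; isomorphism means linear isomorphisms $V^t\cong W^t$ for all $t$ commuting with the structure maps. $\mathbb H_p(X)$ is the module with spaces $H_p(\mathrm{Rips}(X,s))$ and maps $\phi_X^{t,s}$. For a nonempty interval $J\subset\mathbb R$, $\mathbb I_J$ has $I_J^t=\mathbb Z_2$ if $t\in J$, $0$ otherwise, with structure maps the identity when $s,t\in J$ and $0$ otherwise. $\mathbb H_p(X)$ is decomposable if $\mathbb H_p(X)\cong\bigoplus_{k\in K}\mathbb I_{J_k}$ for some indexed family of intervals (unique up to reindexing). The indexed persistence diagram is then $\mathrm{Dgm}_p(X)=\{(k,(\inf J_k,\sup J_k))\colon k\in K\}$. If $X$ is finite, $\mathbb H_p(X)$ is always decomposable. Suprema are taken in the extended reals, and $\vartheta(\infty)=\varphi^{-1}(\infty)=\infty$,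 $[\infty,\infty]=\{\infty\}$. *)

theory Defs
  imports
    "HOL-Analysis.Analysis"
    "HOL-Algebra.Module"
    "HOL-Algebra.AbelCoset"
    "HOL-Library.Z2"
    "HOL-Library.Poly_Mapping"
begin

section \<open>Quasi-isometries and models\<close>

definition hausdorff_dist :: "'a::metric_space set \<Rightarrow> 'a set \<Rightarrow> ereal" where
  "hausdorff_dist A B =
     max (SUP a\<in>A. ereal (infdist a B)) (SUP b\<in>B. ereal (infdist b A))"

definition qi_embedding ::
  "real \<Rightarrow> real \<Rightarrow> 'a::metric_space set \<Rightarrow> 'b::metric_space set \<Rightarrow> ('a \<Rightarrow> 'b) \<Rightarrow> bool" where
  "qi_embedding L \<epsilon> X Y f \<longleftrightarrow>
     f \<in> X \<rightarrow> Y \<and>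
     (\<forall>x1\<in>X. \<forall>x2\<in>X.
        1 / L * dist x1 x2 - \<epsilon> \<le> dist (f x1) (f x2) \<and>
        dist (f x1) (f x2) \<le> L * dist x1 x2 + \<epsilon>)"

definition quasi_isometry ::
  "real \<Rightarrow> real \<Rightarrow> real \<Rightarrow> 'a::metric_space set \<Rightarrow> 'b::metric_space set \<Rightarrow> ('a \<Rightarrow> 'b) \<Rightarrow> bool" where
  "quasi_isometry L \<epsilon> \<delta> X Y f \<longleftrightarrow>
     qi_embedding L \<epsilon> X Y f \<and> hausdorff_dist (f ` X) Y \<le> ereal \<delta>"

definition qi_model ::
  "real \<Rightarrow> real \<Rightarrow> real \<Rightarrow> real \<Rightarrow>
   'a::metric_space set \<Rightarrow> 'a set \<Rightarrow> 'b::metric_space set \<Rightarrow> 'c::metric_space set \<Rightarrow>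
   ('a \<Rightarrow> 'a) \<Rightarrow> ('a \<Rightarrow> 'b) \<Rightarrow> ('b \<Rightarrow> 'c) \<Rightarrow> bool" where
  "qi_model L \<epsilon>0 \<epsilon>1 \<epsilon>2 Xcont Xnet Yclean Ynoisy f0 f1 f2 \<longleftrightarrow>
     Xcont \<noteq> {} \<and> Xnet \<noteq> {} \<and> Yclean \<noteq> {} \<and> Ynoisy \<noteq> {} \<and>
     Xnet \<subseteq> Xcont \<and> finite Xnet \<and>
     quasi_isometry 1 \<epsilon>0 0 Xcont Xnet f0 \<and>
     (\<forall>x\<in>Xcont. dist x (f0 x) \<le> 1 / 2 * \<epsilon>0) \<and>
     quasi_isometry L \<epsilon>1 0 Xnet Yclean f1 \<and>
     quasi_isometry 1 \<epsilon>2 0 Yclean Ynoisy f2"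


section \<open>Vector spaces over the field with two elements\<close>

definition Z2 :: "bit ring" where
  "Z2 = \<lparr>carrier = UNIV, mult = (*), one = 1, zero = 0, add = (+)\<rparr>"

text \<open>
  A vector space over \<open>Z2\<close> is a record \<open>V\<close> with \<open>module Z2 V\<close>.  The record inherits the
  fields \<open>mult\<close> and \<open>one\<close> from \<open>ring\<close>; they play no role for a module and are left undefined.
\<close>

definition linear_map :: "(bit, 'v) module \<Rightarrow> (bit, 'w) module \<Rightarrow> ('v \<Rightarrow> 'w) \<Rightarrow> bool" where
  "linear_map V W f \<longleftrightarrow>
     f \<in> carrier V \<rightarrow> carrier W \<and>
     (\<forall>x\<in>carrier V. \<forall>y\<in>carrier V. f (x \<oplus>\<^bsub>V\<^esub> y) = f x \<oplus>\<^bsub>W\<^esub> f y) \<and>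
     (\<forall>a\<in>carrier Z2. \<forall>x\<in>carrier V. f (a \<odot>\<^bsub>V\<^esub> x) = a \<odot>\<^bsub>W\<^esub> f x)"

definition linear_iso :: "(bit, 'v) module \<Rightarrow> (bit, 'w) module \<Rightarrow> ('v \<Rightarrow> 'w) \<Rightarrow> bool" where
  "linear_iso V W f \<longleftrightarrow> linear_map V W f \<and> bij_betw f (carrier V) (carrier W)"

definition quotient_space :: "(bit, 'v) module \<Rightarrow> 'v set \<Rightarrow> (bit, 'v set) module" where
  "quotient_space V U =
     \<lparr>carrier = a_rcosets\<^bsub>V\<^esub> U, mult = undefined, one = undefined,
      zero = U, add = set_add V, smult = (\<lambda>a A. \<Union>x\<in>A. U +>\<^bsub>V\<^esub> (a \<odot>\<^bsub>V\<^esub> x))\<rparr>"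


section \<open>Persistence modules and diagrams\<close>

text \<open>\<open>pmap V t s\<close> is the structure map from \<open>pspace V s\<close> to \<open>pspace V t\<close>, for \<open>s \<le> t\<close>.
  The record holds the data only; the module and functoriality laws hold for the modules built below.\<close>

record 'v pers_module =
  pspace :: "real \<Rightarrow> (bit, 'v) module"
  pmap :: "real \<Rightarrow> real \<Rightarrow> 'v \<Rightarrow> 'v"

definition pm_isomorphic :: "'v pers_module \<Rightarrow> 'w pers_module \<Rightarrow> bool" where
  "pm_isomorphic V W \<longleftrightarrow>
     (\<exists>g. (\<forall>t. linear_iso (pspace V t) (pspace W t) (g t)) \<and>
          (\<forall>s t. s \<le> t \<longrightarrow>
             (\<forall>x\<in>carrier (pspace V s). g t (pmap V t s x) = pmap W t s (g s x))))"

definition interval_module :: "real set \<Rightarrow> bit pers_module" where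
  "interval_module J =
     \<lparr>pspace = (\<lambda>t. \<lparr>carrier = (if t \<in> J then UNIV else {0}),
                     mult = undefined, one = undefined,
                     zero = 0, add = (+), smult = (*)\<rparr>),
      pmap = (\<lambda>t s x. if s \<in> J \<and> t \<in> J then x else 0)\<rparr>"

definition direct_sum :: "'k set \<Rightarrow> ('k \<Rightarrow> 'v pers_module) \<Rightarrow> ('k \<Rightarrow> 'v) pers_module" where
  "direct_sum K M =
     \<lparr>pspace = (\<lambda>t.
        \<lparr>carrier = {x \<in> \<Pi>\<^sub>E k\<in>K. carrier (pspace (M k) t).
                      finite {k \<in> K. x k \<noteq> \<zero>\<^bsub>pspace (M k) t\<^esub>}},
         mult = undefined, one = undefined,
         zero = (\<lambda>k\<in>K. \<zero>\<^bsub>pspace (M k) t\<^esub>),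
         add = (\<lambda>x y. \<lambda>k\<in>K. x k \<oplus>\<^bsub>pspace (M k) t\<^esub> y k),
         smult = (\<lambda>a x. \<lambda>k\<in>K. a \<odot>\<^bsub>pspace (M k) t\<^esub> x k)\<rparr>),
      pmap = (\<lambda>t s x. \<lambda>k\<in>K. pmap (M k) t s (x k))\<rparr>"

definition interval_decomposition :: "'v pers_module \<Rightarrow> 'k set \<Rightarrow> ('k \<Rightarrow> real set) \<Rightarrow> bool" where
  "interval_decomposition V K J \<longleftrightarrow>
     (\<forall>k\<in>K. J k \<noteq> {} \<and> is_interval (J k)) \<and>
     pm_isomorphic V (direct_sum K (\<lambda>k. interval_module (J k)))"

definition dgm :: "'k set \<Rightarrow> ('k \<Rightarrow> real set) \<Rightarrow> ('k \<times> ereal \<times> ereal) set" where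
  "dgm K J = (\<lambda>k. (k, (INF t\<in>J k. ereal t, SUP t\<in>J k. ereal t))) ` K"

text \<open>
  \<open>is_dgm V D\<close>: \<open>V\<close> is decomposable and \<open>D\<close> is its indexed persistence diagram.  This is a
  relation because the diagram is determined by \<open>V\<close> only up to reindexing, including the choice
  of the index type.  A theorem about "the" diagram is stated for every \<open>D\<close> with \<open>is_dgm V D\<close>;
  for the Rips homology of a finite metric space such a \<open>D\<close> always exists.
\<close>

definition is_dgm :: "'v pers_module \<Rightarrow> ('k \<times> ereal \<times> ereal) set \<Rightarrow> bool" where
  "is_dgm V D \<longleftrightarrow> (\<exists>K J. interval_decomposition V K J \<and> D = dgm K J)"


section \<open>Rips homology\<close>

text \<open>The \<open>p\<close>-simplex \<open>[x\<^sub>0, \<dots>, x\<^sub>p]\<close> is the list of its vertices, of length \<open>p + 1\<close>.\<close>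

definition rips_simplices :: "'a::metric_space set \<Rightarrow> nat \<Rightarrow> real \<Rightarrow> 'a list set" where
  "rips_simplices X p s =
     {\<sigma>. length \<sigma> = p + 1 \<and> set \<sigma> \<subseteq> X \<and> diameter (set \<sigma>) \<le> s}"

definition rips_chains ::
  "'a::metric_space set \<Rightarrow> nat \<Rightarrow> real \<Rightarrow> (bit, 'a list \<Rightarrow>\<^sub>0 bit) module" where
  "rips_chains X p s =
     \<lparr>carrier = {c. Poly_Mapping.keys c \<subseteq> rips_simplices X p s},
      mult = undefined, one = undefined,
      zero = 0, add = (+), smult = (\<lambda>a. Poly_Mapping.map ((*) a))\<rparr>"

definition face :: "nat \<Rightarrow> 'a list \<Rightarrow> 'a list" where
  "face i \<sigma> = take i \<sigma> @ drop (Suc i) \<sigma>"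

text \<open>The case \<open>p = 0\<close> is separate because there are no chains in negative degrees.\<close>

definition boundary :: "nat \<Rightarrow> ('a list \<Rightarrow>\<^sub>0 bit) \<Rightarrow> ('a list \<Rightarrow>\<^sub>0 bit)" where
  "boundary p c =
     (if p = 0 then 0
      else \<Sum>\<sigma>\<in>Poly_Mapping.keys c. \<Sum>i=0..p.
             Poly_Mapping.single (face i \<sigma>) ((-1) ^ i * Poly_Mapping.lookup c \<sigma>))"

definition rips_cycles :: "'a::metric_space set \<Rightarrow> nat \<Rightarrow> real \<Rightarrow> ('a list \<Rightarrow>\<^sub>0 bit) set" where
  "rips_cycles X p s = {c \<in> carrier (rips_chains X p s). boundary p c = 0}"

definition rips_boundaries :: "'a::metric_space set \<Rightarrow> nat \<Rightarrow> real \<Rightarrow> ('a list \<Rightarrow>\<^sub>0 bit) set" where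
  "rips_boundaries X p s = boundary (Suc p) ` carrier (rips_chains X (Suc p) s)"

definition rips_homology ::
  "'a::metric_space set \<Rightarrow> nat \<Rightarrow> real \<Rightarrow> (bit, ('a list \<Rightarrow>\<^sub>0 bit) set) module" where
  "rips_homology X p s =
     quotient_space ((rips_chains X p s)\<lparr>carrier := rips_cycles X p s\<rparr>) (rips_boundaries X p s)"

text \<open>
  The map induced by inclusion sends the class of a cycle \<open>c\<close> at scale \<open>s\<close> to the class of \<open>c\<close>
  at scale \<open>t\<close>; the union ranges over all representatives \<open>c\<close> of the given class.
\<close>

definition rips_pm :: "nat \<Rightarrow> 'a::metric_space set \<Rightarrow> ('a list \<Rightarrow>\<^sub>0 bit) set pers_module" where
  "rips_pm p X =
     \<lparr>pspace = rips_homology X p,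
      pmap = (\<lambda>t s A. \<Union>c\<in>A. rips_boundaries X p t +>\<^bsub>rips_chains X p t\<^esub> c)\<rparr>"


section \<open>The bounds\<close>

definition theta :: "real \<Rightarrow> real \<Rightarrow> real \<Rightarrow> real \<Rightarrow> ereal \<Rightarrow> ereal" where
  "theta L \<epsilon>0 \<epsilon>1 \<epsilon>2 t = ereal L * (t + ereal \<epsilon>2 + ereal \<epsilon>1) + ereal \<epsilon>0"

definition phi_inv :: "real \<Rightarrow> real \<Rightarrow> real \<Rightarrow> real \<Rightarrow> ereal \<Rightarrow> ereal" where
  "phi_inv L \<epsilon>0 \<epsilon>1 \<epsilon>2 t = (t - ereal (L * \<epsilon>0) - ereal \<epsilon>1 - ereal \<epsilon>2) / ereal L"

definition long_part ::
  "real \<Rightarrow> real \<Rightarrow> real \<Rightarrow> real \<Rightarrow> ('k \<times> ereal \<times> ereal) set \<Rightarrow> ('k \<times> ereal \<times> ereal) set" where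
  "long_part L \<epsilon>0 \<epsilon>1 \<epsilon>2 D =
     {(k, (a, b)) \<in> D. theta L \<epsilon>0 \<epsilon>1 \<epsilon>2 a < phi_inv L \<epsilon>0 \<epsilon>1 \<epsilon>2 b}"

end

theory Submission
  imports Defs
begin

text \<open>
  The composite \<open>F = f2 \<circ> f1 \<circ> f0\<close> maps \<open>Xcont\<close> onto the finite space \<open>Ynoisy\<close>, because
  each factor has finite image at Hausdorff distance \<open>0\<close> from its target.  Let \<open>G\<close> be a
  section, so that \<open>F \<circ> G\<close> is the identity.  The quasi-isometry estimates show that \<open>G\<close>
  maps simplices of diameter at most \<open>s\<close> to simplices of diameter at most \<open>theta s\<close>, and
  that \<open>F\<close> maps those of diameter at most \<open>u\<close> to those of diameter at most
  \<open>phi u = L * u + L * \<epsilon>0 + \<epsilon>1 + \<epsilon>2\<close>, whose inverse is \<open>phi_inv\<close>.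
  On homology the composite of the induced morphisms from a scale \<open>s \<ge> 0\<close> to the scale
  \<open>h s = phi (theta s)\<close> is the structure map of \<open>Ynoisy\<close>: up to the shift \<open>h\<close>, the
  persistence module of \<open>Ynoisy\<close> is a retract of that of \<open>Xcont\<close>.

  The rest is algebra of interval decompositions.  A morphism between interval modules is a
  scalar, so the two induced morphisms become matrices over the field with two elements, and
  their product is the identity wherever a single scale sees the bars involved.  A nonzero
  scalar from a bar to another forces the second one to start and to end no later than the
  shifted first one (\<open>lo_le\<close>, \<open>hi_le\<close>).  So a bar of \<open>Xcont\<close> through which the
  round trip passes from a bar to itself satisfies the four required inequalities, and is
  called compatible with that bar.

  An injection into compatible bars exists by Hall's theorem (\<open>hall_matching\<close>) if every
  finite set \<open>A\<close> of long bars has at least as many compatible bars as elements.  To see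
  this, restrict the two matrices to \<open>A\<close> and to the bars compatible with a member
  of \<open>A\<close>.  The product of the restrictions has entries \<open>1\<close> on the diagonal; off the
  diagonal it may have other nonzero entries only at pairs of bars in one of a few bad
  positions (\<open>obstructed\<close>).  Along bad pairs the bars strictly decrease in a suitable order
  (\<open>exists_unobstructed\<close>), so the product is triangular and the first factor has independent
  columns (\<open>card_le_card_if_columns_independent\<close>).  Finite bars are ordered for
  \<open>L = 1\<close> by their midpoints, for \<open>L > 1\<close> by the product of the distances of
  their endpoints from the fixed point of \<open>h\<close>; infinite bars are the largest.
\<close>

section \<open>Matchings\<close>

text \<open>
  Hall's marriage theorem, by induction on the size of \<open>K\<close>.  If some nonempty proper
  subset \<open>A\<close> has exactly as many neighbours as elements, then \<open>A\<close> is matched into its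
  neighbours and the rest of \<open>K\<close> into what remains.  Otherwise every such subset has a
  neighbour to spare, and one pair can be fixed arbitrarily.
\<close>

lemma hall_matching:
  fixes N :: "'a \<Rightarrow> 'b set"
  assumes "finite K" and "\<And>k. k \<in> K \<Longrightarrow> finite (N k)"
    and "\<And>A. A \<subseteq> K \<Longrightarrow> card A \<le> card (\<Union>k\<in>A. N k)"
  shows "\<exists>m. inj_on m K \<and> (\<forall>k\<in>K. m k \<in> N k)"
  using assms
proof (induction "card K" arbitrary: K N rule: less_induct)
  case less
  note fin = less.prems(1) and finN = less.prems(2) and hall = less.prems(3)
  show ?case
  proof (cases "K = {}")
    case True
    then show ?thesis by simp
  next
    case False
    show ?thesis
    proof (cases "\<exists>A. A \<subset> K \<and> A \<noteq> {} \<and> card (\<Union>k\<in>A. N k) = card A")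
      case True
      then obtain A where A: "A \<subset> K" "A \<noteq> {}" and tight: "card (\<Union>k\<in>A. N k) = card A"
        by blast
      have finA: "finite A" using A fin by (meson finite_subset psubset_imp_subset)
      let ?NA = "\<Union>k\<in>A. N k"
      have finNA: "finite ?NA" using finA finN A by blast
      have "\<exists>m. inj_on m A \<and> (\<forall>k\<in>A. m k \<in> N k)"
      proof (rule less.hyps)
        show "card A < card K" using A fin by (simp add: psubset_card_mono)
      qed (use A finA finN hall in \<open>auto simp: subset_iff\<close>)
      then obtain m1 where m1: "inj_on m1 A" "\<And>k. k \<in> A \<Longrightarrow> m1 k \<in> N k" by blast
      have "\<exists>m. inj_on m (K - A) \<and> (\<forall>k\<in>K - A. m k \<in> N k - ?NA)"
      proof (rule less.hyps)
        show "card (K - A) < card K"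
          using A fin by (intro psubset_card_mono) auto
        show "card B \<le> card (\<Union>k\<in>B. N k - ?NA)" if B: "B \<subseteq> K - A" for B
        proof -
          have finB: "finite B" using B fin finite_subset by blast
          have fin': "finite (\<Union>k\<in>B. N k - ?NA)" using finB finN B by blast
          have "card B + card A = card (B \<union> A)"
            using B finA finB by (subst card_Un_disjoint) auto
          also have "\<dots> \<le> card (\<Union>k\<in>B \<union> A. N k)"
            using B A by (intro hall) auto
          also have "(\<Union>k\<in>B \<union> A. N k) = (\<Union>k\<in>B. N k - ?NA) \<union> ?NA" by blast
          also have "card \<dots> = card (\<Union>k\<in>B. N k - ?NA) + card ?NA"
            using fin' finNA by (subst card_Un_disjoint) auto
          finally show ?thesis using tight by simp
        qed
      qed (use fin finN in auto)
      then obtain m2 where m2: "inj_on m2 (K - A)" "\<And>k. k \<in> K - A \<Longrightarrow> m2 k \<in> N k - ?NA"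
        by blast
      define m where "m k = (if k \<in> A then m1 k else m2 k)" for k
      have "inj_on m K"
      proof -
        have "inj_on m A" using m1(1) by (rule inj_on_cong[THEN iffD1, rotated]) (simp add: m_def)
        moreover have "inj_on m (K - A)"
          using m2(1) by (rule inj_on_cong[THEN iffD1, rotated]) (simp add: m_def)
        moreover have "m ` A \<inter> m ` (K - A) = {}"
          using m1(2) m2(2) by (fastforce simp: m_def)
        ultimately have "inj_on m (A \<union> (K - A))"
          by (subst inj_on_Un) auto
        then show ?thesis using A by (simp add: Un_absorb1 psubset_imp_subset)
      qed
      moreover have "\<forall>k\<in>K. m k \<in> N k" using m1 m2 by (auto simp: m_def)
      ultimately show ?thesis by blast
    next
      case slack: False
      obtain k where k: "k \<in> K" using False by blast
      have "card {k} \<le> card (\<Union>k\<in>{k}. N k)" using k by (intro hall) auto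
      then obtain y where y: "y \<in> N k" by fastforce
      have "\<exists>m. inj_on m (K - {k}) \<and> (\<forall>j\<in>K - {k}. m j \<in> N j - {y})"
      proof (rule less.hyps)
        show "card (K - {k}) < card K" using k fin by (rule card_Diff1_less[rotated])
        show "card B \<le> card (\<Union>j\<in>B. N j - {y})" if B: "B \<subseteq> K - {k}" for B
        proof (cases "B = {}")
          case False
          have "B \<subset> K" using B k by blast
          with False slack hall have "card B < card (\<Union>j\<in>B. N j)"
            by (metis le_neq_implies_less psubset_imp_subset)
          moreover have "(\<Union>j\<in>B. N j - {y}) = (\<Union>j\<in>B. N j) - {y}" by blast
          ultimately show ?thesis by (auto simp: card_Diff_singleton_if)
        qed simp
      qed (use fin finN in auto)
      then obtain m where m: "inj_on m (K - {k})" "\<And>j. j \<in> K - {k} \<Longrightarrow> m j \<in> N j - {y}" by blast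
      have "inj_on (m(k := y)) (K - {k})"
        using m(1) by (rule inj_on_cong[THEN iffD1, rotated]) simp
      moreover have "y \<notin> (m(k := y)) ` (K - {k})" using m(2) by auto
      ultimately have "inj_on (m(k := y)) (insert k (K - {k}))"
        by (subst inj_on_insert) simp
      then have "inj_on (m(k := y)) K" using k by (simp add: insert_absorb)
      moreover have "\<forall>j\<in>K. (m(k := y)) j \<in> N j" using m y by auto
      ultimately show ?thesis by blast
    qed
  qed
qed

text \<open>
  Coordinates below are treated as elements of a field; by default the simplifier would
  turn their sums and products into bit operations.
\<close>

declare add_bit_eq_xor [simp del] mult_bit_eq_and [simp del]

lemma bit_add_self: "x + x = (0 :: bit)"
  by (cases x) auto

text \<open>
  The hypothesis says that the columns of \<open>g\<close> indexed by \<open>A\<close>, restricted to the rows \<open>B\<close>,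
  are linearly independent.  Over two elements a linear combination of columns is the sum over a
  subset, so comparing the numbers of subsets replaces the dimension count: two subsets
  of \<open>A\<close> with equal column sums have a symmetric difference with column sum zero.
\<close>

lemma card_le_card_if_columns_independent:
  fixes g :: "'b \<Rightarrow> 'a \<Rightarrow> bit"
  assumes "finite A" "finite B"
    and indep: "\<And>U. U \<subseteq> A \<Longrightarrow> U \<noteq> {} \<Longrightarrow> \<exists>l\<in>B. (\<Sum>k\<in>U. g l k) \<noteq> 0"
  shows "card A \<le> card B"
proof -
  define im where "im S = {l \<in> B. (\<Sum>k\<in>S. g l k) \<noteq> 0}" for S
  have "inj_on im (Pow A)"
  proof (rule inj_onI)
    fix S S' assume S: "S \<in> Pow A" "S' \<in> Pow A" and eq: "im S = im S'"
    define U where "U = (S - S') \<union> (S' - S)"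
    have fin: "finite S" "finite S'" using S \<open>finite A\<close> finite_subset by auto
    have "(\<Sum>k\<in>U. g l k) = 0" if "l \<in> B" for l
    proof -
      have "(\<Sum>k\<in>S. g l k) = (\<Sum>k\<in>S \<inter> S'. g l k) + (\<Sum>k\<in>S - S'. g l k)"
        using fin by (intro sum.Int_Diff)
      moreover have "(\<Sum>k\<in>S'. g l k) = (\<Sum>k\<in>S \<inter> S'. g l k) + (\<Sum>k\<in>S' - S. g l k)"
        using sum.Int_Diff[of S' "g l" S] fin by (simp only: Int_commute)
      moreover have "(\<Sum>k\<in>S. g l k) = (\<Sum>k\<in>S'. g l k)"
      proof -
        have "l \<in> im S \<longleftrightarrow> l \<in> im S'" using eq by simp
        then have "(\<Sum>k\<in>S. g l k) \<noteq> 0 \<longleftrightarrow> (\<Sum>k\<in>S'. g l k) \<noteq> 0"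
          using that unfolding im_def by blast
        then show ?thesis by (cases "\<Sum>k\<in>S. g l k"; cases "\<Sum>k\<in>S'. g l k") auto
      qed
      ultimately have "(\<Sum>k\<in>S - S'. g l k) = (\<Sum>k\<in>S' - S. g l k)"
        by (metis add_left_cancel)
      moreover have "(\<Sum>k\<in>U. g l k) = (\<Sum>k\<in>S - S'. g l k) + (\<Sum>k\<in>S' - S. g l k)"
        unfolding U_def using fin by (intro sum.union_disjoint) auto
      ultimately show ?thesis by (simp only: bit_add_self)
    qed
    then have "U = {}" using indep[of U] S unfolding U_def by blast
    then show "S = S'" unfolding U_def by blast
  qed
  moreover have "im ` Pow A \<subseteq> Pow B" unfolding im_def by auto
  ultimately have "card (Pow A) \<le> card (Pow B)"
    using \<open>finite B\<close> by (intro card_inj_on_le[of im]) auto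
  then show ?thesis using assms by (simp add: card_Pow)
qed

section \<open>Affine shifts of endpoints\<close>

definition aff :: "real \<Rightarrow> real \<Rightarrow> ereal \<Rightarrow> ereal" where
  "aff L c x = ereal L * x + ereal c"

lemma aff_ereal [simp]: "aff L c (ereal s) = ereal (L * s + c)"
  by (simp add: aff_def)

lemma aff_infty [simp]: "L > 0 \<Longrightarrow> aff L c \<infinity> = \<infinity>" "L > 0 \<Longrightarrow> aff L c (-\<infinity>) = -\<infinity>"
  by (auto simp: aff_def)

lemma aff_less_iff [simp]: "L > 0 \<Longrightarrow> aff L c x < aff L c y \<longleftrightarrow> x < y"
  by (cases x; cases y) auto

lemma aff_le_iff [simp]: "L > 0 \<Longrightarrow> aff L c x \<le> aff L c y \<longleftrightarrow> x \<le> y"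
  by (simp flip: not_less)

lemma aff_surj: 
  assumes "L > 0" obtains z where "y = aff L c z"
proof (cases y)
  case (real r)
  then have "y = aff L c (ereal ((r - c) / L))" using assms by simp
  then show ?thesis using that by blast
next
  case PInf
  then have "y = aff L c \<infinity>" using assms by simp
  then show ?thesis using that by blast
next
  case MInf
  then have "y = aff L c (-\<infinity>)" using assms by simp
  then show ?thesis using that by blast
qed

text \<open>
  An increasing affine bijection of the extended reals commutes with infima; this is the half that
  transfers lower bounds from the points of a bar to its left endpoint.
\<close>

lemma le_aff_INF:
  assumes "L > 0" and "\<And>s. s \<in> J \<Longrightarrow> y \<le> ereal (L * s + c)"
  shows "y \<le> aff L c (INF s\<in>J. ereal s)"
proof -
  obtain z where z: "y = aff L c z" using aff_surj[OF assms(1)] by blast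
  have "z \<le> ereal s" if "s \<in> J" for s
    using assms(2)[OF that] unfolding z aff_ereal[symmetric] aff_le_iff[OF assms(1)] .
  then show ?thesis unfolding z aff_le_iff[OF assms(1)] by (rule INF_greatest)
qed

section \<open>Ordering the long bars\<close>

lemma finite_lex_max:
  fixes p q :: "'a \<Rightarrow> real"
  assumes "finite S" "S \<noteq> {}"
  shows "\<exists>x\<in>S. \<forall>y\<in>S. p y < p x \<or> (p y = p x \<and> q y \<le> q x)"
proof -
  define M where "M = Max (p ` S)"
  define T where "T = {x \<in> S. p x = M}"
  have le: "p y \<le> M" if "y \<in> S" for y using assms that by (simp add: M_def)
  have "M \<in> p ` S" unfolding M_def using assms by (intro Max_in) auto
  then have T: "finite T" "T \<noteq> {}" using assms by (auto simp: T_def)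
  then have "Max (q ` T) \<in> q ` T" by (intro Max_in) auto
  then obtain x where x: "x \<in> T" "q x = Max (q ` T)" by auto
  have "q y \<le> q x" if "y \<in> T" for y using T that by (simp add: x)
  then show ?thesis using x le unfolding T_def by force
qed

text \<open>
  Here \<open>(a, b)\<close> and \<open>(a', b')\<close> are the endpoints of two bars of one module and
  \<open>aff M C\<close> is the shift of the round trip to the other module and back.  The first three
  alternatives are the only positions of the bars in which the round trip can go from \<open>(a, b)\<close> to
  \<open>(a', b')\<close> through a bar that is close to neither of them.  In the last one the bar
  \<open>(a', b')\<close> has died before the shifted bar is born, so that no single scale sees both.
\<close>

definition obstructed :: "real \<Rightarrow> real \<Rightarrow> ereal \<times> ereal \<Rightarrow> ereal \<times> ereal \<Rightarrow> bool" where
  "obstructed M C I I' \<longleftrightarrow>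
     (case (I, I') of ((a, b), (a', b')) \<Rightarrow>
        a' < a \<and> b' < b \<or>
        aff M C a' < a \<and> b' \<le> aff M C b \<or>
        aff M C b' < b \<and> a' \<le> aff M C a \<or>
        b' \<le> aff M C a)"

lemma le_aff:
  assumes "M \<ge> 1" "C \<ge> 0" "0 \<le> x"
  shows "x \<le> aff M C x"
proof (cases x)
  case (real r)
  then have "1 * r \<le> M * r" using assms by (intro mult_right_mono) auto
  then show ?thesis using real assms by simp
qed (use assms in auto)

text \<open>
  Let \<open>h x = M * x + C\<close>.  The quantity \<open>\<alpha>\<close> is monotone in both endpoints on the
  nonnegative reals and satisfies \<open>\<alpha> (h x) y = \<alpha> x (h y)\<close>, so that an advantage of
  one shift at one endpoint compensates for a loss of one shift at the other.  For \<open>M = 1\<close> it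
  is a multiple of the midpoint of the bar; for \<open>M > 1\<close> it is, up to affine rescaling, the
  product of the distances of \<open>a\<close> and \<open>b\<close> from the fixed point of \<open>h\<close>.  Strict
  monotonicity fails when \<open>C = 0\<close> and either \<open>M = 1\<close> or one endpoint is \<open>0\<close>; the sum
  \<open>a + b\<close> breaks these ties.
\<close>

lemma not_obstructed_if_lex_le:
  fixes a b a' b' M C :: real
  defines "\<alpha> \<equiv> \<lambda>a b. (M - 1) * (a * b) + C * (a + b)"
  assumes MC: "M \<ge> 1" "C \<ge> 0" and nonneg: "0 \<le> a" "0 \<le> a'"
    and long: "M * a + C < b" "M * a' + C < b'"
    and lex: "\<alpha> a b < \<alpha> a' b' \<or> \<alpha> a b = \<alpha> a' b' \<and> a + b \<le> a' + b'"
  shows "\<not> obstructed M C (ereal a, ereal b) (ereal a', ereal b')"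
proof -
  have expand: "x \<le> M * x + C" if "0 \<le> x" for x
    using mult_right_mono[of 1 M x] that MC by simp
  have pos: "0 < b" "0 < b'"
    using expand[OF nonneg(1)] expand[OF nonneg(2)] long nonneg by linarith+
  have mono: "\<alpha> x y \<le> \<alpha> x' y'" if "x \<le> x'" "y \<le> y'" "0 \<le> x" "0 \<le> y" for x y x' y'
    unfolding \<alpha>_def using that MC by (intro add_mono mult_left_mono mult_mono) auto
  have slide: "\<alpha> (M * x + C) y = \<alpha> x (M * y + C)" for x y
    unfolding \<alpha>_def by (simp add: algebra_simps)
  (* The first three alternatives list the degenerate cases in which alpha does not grow with x. *)
  have strict: "x = x' \<or> M = 1 \<and> C = 0 \<or> C = 0 \<and> y = 0 \<or> \<alpha> x y < \<alpha> x' y" 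
    if "x \<le> x'" "0 \<le> y" for x x' y
  proof -
    have eq: "\<alpha> x' y - \<alpha> x y = (x' - x) * ((M - 1) * y + C)"
      unfolding \<alpha>_def by (simp add: algebra_simps)
    have "0 \<le> (M - 1) * y" using MC that by simp
    then consider "0 < (M - 1) * y + C" | "(M - 1) * y = 0" "C = 0" using MC by linarith
    then show ?thesis
    proof cases
      case 1
      show ?thesis
      proof (cases "x = x'")
        case False
        then have "0 < (x' - x) * ((M - 1) * y + C)" using 1 that by simp
        then show ?thesis using eq by linarith
      qed simp
    qed auto
  qed
  have sym: "\<alpha> x y = \<alpha> y x" for x y unfolding \<alpha>_def by (simp add: algebra_simps)
  have first: "\<not> (a' < a \<and> b' < b)"
    using mono[of a' a b' b] lex nonneg pos by auto
  moreover have "\<not> (M * a' + C < a \<and> b' \<le> M * b + C)"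
  proof
    assume h: "M * a' + C < a \<and> b' \<le> M * b + C"
    have "\<alpha> a' b' \<le> \<alpha> a' (M * b + C)" using h nonneg pos by (intro mono) auto
    also have "\<dots> = \<alpha> (M * a' + C) b" by (simp add: slide)
    finally have le: "\<alpha> a' b' \<le> \<alpha> (M * a' + C) b" .
    consider "M = 1" "C = 0" | "\<alpha> (M * a' + C) b < \<alpha> a b"
      using strict[of "M * a' + C" a b] h pos by auto
    then show False
    proof cases
      case 1
      then show False using h lex le mono[of a' a b b] nonneg pos by auto
    qed (use le lex in linarith)
  qed
  moreover have "\<not> (M * b' + C < b \<and> a' \<le> M * a + C)"
  proof
    assume h: "M * b' + C < b \<and> a' \<le> M * a + C"
    have "\<alpha> a' b' \<le> \<alpha> (M * a + C) b'" using h nonneg pos by (intro mono) auto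
    also have "\<dots> = \<alpha> (M * b' + C) a" by (metis slide sym)
    finally have le: "\<alpha> a' b' \<le> \<alpha> (M * b' + C) a" .
    have le2: "\<alpha> (M * b' + C) a \<le> \<alpha> a b" 
      using mono[of "M * b' + C" b a a] h nonneg expand[of b'] pos by (simp add: sym)
    consider "M = 1" "C = 0" | "C = 0" "a = 0" | "\<alpha> (M * b' + C) a < \<alpha> a b"
      using strict[of "M * b' + C" b a] h nonneg by (auto simp: sym)
    moreover have "b' < b" using h expand[of b'] pos by linarith
    ultimately show False
    proof cases
      case 1
      then show False using h lex le le2 by auto
    next
      case 2
      then show False using h lex le le2 \<open>b' < b\<close> by auto
    qed (use le lex in linarith)
  qed
  moreover have "\<not> b' \<le> M * a + C"
  proof
    assume h: "b' \<le> M * a + C"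
    then have "a \<le> a'" using first long by linarith
    then have "M * a \<le> M * a'" using MC by (intro mult_left_mono) auto
    then show False using h long by linarith
  qed
  ultimately show ?thesis by (simp add: obstructed_def)
qed

text \<open>
  An infinite bar, if there is one, is preferred as \<open>k'\<close>: the way from a finite bar to it is
  never obstructed, and between infinite bars only the births matter.  Finite bars are ordered by the previous lemma.
\<close>

lemma exists_unobstructed:
  fixes a b :: "'k \<Rightarrow> ereal"
  assumes MC: "M \<ge> 1" "C \<ge> 0" and S: "finite S" "S \<noteq> {}"
    and nonneg: "\<And>k. k \<in> S \<Longrightarrow> 0 \<le> a k"
    and long: "\<And>k. k \<in> S \<Longrightarrow> aff M C (a k) < b k"
  shows "\<exists>k'\<in>S. \<forall>k\<in>S. \<not> obstructed M C (a k, b k) (a k', b k')"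
proof -
  have M0: "M > 0" using MC by simp
  have afin: "\<bar>a k\<bar> \<noteq> \<infinity>" if "k \<in> S" for k
    using nonneg[OF that] long[OF that] M0 by (cases "a k") auto
  show ?thesis
  proof (cases "\<exists>k\<in>S. b k = \<infinity>")
    case True
    define T where "T = {k \<in> S. b k = \<infinity>}"
    have T: "finite T" "T \<noteq> {}" using True S by (auto simp: T_def)
    then have "Max (a ` T) \<in> a ` T" by (intro Max_in) auto
    then obtain k' where k': "k' \<in> T" "a k' = Max (a ` T)" by auto
    have "\<not> obstructed M C (a k, b k) (a k', b k')" if k: "k \<in> S" for k
    proof -
      have b': "b k' = \<infinity>" and k'S: "k' \<in> S" using k' by (auto simp: T_def)
      have "\<not> aff M C (a k') < a k" if "b k = \<infinity>"
      proof -
        have "a k \<le> a k'" using that k T unfolding k'(2) by (intro Max_ge) (auto simp: T_def)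
        then show ?thesis using le_aff[OF MC nonneg[OF k'S]] by simp
      qed
      moreover have "b k = \<infinity>" if "aff M C (b k) = \<infinity>"
        using that M0 long[OF k] by (cases "b k") auto
      moreover have "aff M C (a k) \<noteq> \<infinity>" using afin[OF k] M0 by (cases "a k") auto
      ultimately show ?thesis using b' M0 by (auto simp: obstructed_def)
    qed
    moreover have "k' \<in> S" using k' by (auto simp: T_def)
    ultimately show ?thesis by blast
  next
    case False
    have bfin: "\<bar>b k\<bar> \<noteq> \<infinity>" if "k \<in> S" for k
      using nonneg[OF that] long[OF that] False that M0 by (cases "a k"; cases "b k") auto
    define ra where "ra k = real_of_ereal (a k)" for k
    define rb where "rb k = real_of_ereal (b k)" for k
    have real: "a k = ereal (ra k)" "b k = ereal (rb k)" if "k \<in> S" for k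
      using afin[OF that] bfin[OF that] by (simp_all add: ra_def rb_def ereal_real)
    obtain k' where k': "k' \<in> S" and max:
      "\<And>k. k \<in> S \<Longrightarrow> (M - 1) * (ra k * rb k) + C * (ra k + rb k) < (M - 1) * (ra k' * rb k') + C * (ra k' + rb k')
        \<or> (M - 1) * (ra k * rb k) + C * (ra k + rb k) = (M - 1) * (ra k' * rb k') + C * (ra k' + rb k')
          \<and> ra k + rb k \<le> ra k' + rb k'"
      using finite_lex_max[OF S, of "\<lambda>k. (M - 1) * (ra k * rb k) + C * (ra k + rb k)" "\<lambda>k. ra k + rb k"]
      by blast
    have "\<not> obstructed M C (a k, b k) (a k', b k')" if k: "k \<in> S" for k
      unfolding real[OF k] real[OF k']
      using nonneg[OF k] nonneg[OF k'] long[OF k] long[OF k'] max[OF k] MC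
      by (intro not_obstructed_if_lex_le) (auto simp: real[OF k] real[OF k'])
    then show ?thesis using k' by blast
  qed
qed

section \<open>Interval coordinates and matrix entries\<close>

abbreviation lo :: "real set \<Rightarrow> ereal" where "lo I \<equiv> INF t\<in>I. ereal t"
abbreviation hi :: "real set \<Rightarrow> ereal" where "hi I \<equiv> SUP t\<in>I. ereal t"

text \<open>
  An interval decomposition assigns to each element at scale \<open>t\<close> a finitely supported vector
  with one coordinate for each bar alive at \<open>t\<close>.  These axioms record what such coordinates
  satisfy, with coordinate \<open>0\<close> for a bar that is not alive; the proof never returns to the
  isomorphism with the direct sum.
\<close>

locale interval_coordinates =
  fixes V :: "'v pers_module" and K :: "'k set" and J :: "'k \<Rightarrow> real set"
    and co :: "real \<Rightarrow> 'v \<Rightarrow> 'k \<Rightarrow> bit"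
  assumes interval: "k \<in> K \<Longrightarrow> is_interval (J k)"
    and add_closed: "x \<in> carrier (pspace V t) \<Longrightarrow> y \<in> carrier (pspace V t) \<Longrightarrow>
          x \<oplus>\<^bsub>pspace V t\<^esub> y \<in> carrier (pspace V t)"
    and pmap_closed: "s \<le> t \<Longrightarrow> x \<in> carrier (pspace V s) \<Longrightarrow> pmap V t s x \<in> carrier (pspace V t)"
    and co_eq_1D: "x \<in> carrier (pspace V t) \<Longrightarrow> co t x k = 1 \<Longrightarrow> k \<in> K \<and> t \<in> J k"
    and co_finite: "x \<in> carrier (pspace V t) \<Longrightarrow> finite {k. co t x k = 1}"
    and co_add: "x \<in> carrier (pspace V t) \<Longrightarrow> y \<in> carrier (pspace V t) \<Longrightarrow>
          co t (x \<oplus>\<^bsub>pspace V t\<^esub> y) k = co t x k + co t y k"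
    and co_pmap: "s \<le> t \<Longrightarrow> x \<in> carrier (pspace V s) \<Longrightarrow>
          co t (pmap V t s x) k = (if t \<in> J k then co s x k else 0)"
    and co_inj: "x \<in> carrier (pspace V t) \<Longrightarrow> y \<in> carrier (pspace V t) \<Longrightarrow>
          (\<And>k. co t x k = co t y k) \<Longrightarrow> x = y"
    and co_basis: "k \<in> K \<Longrightarrow> t \<in> J k \<Longrightarrow>
          \<exists>x\<in>carrier (pspace V t). \<forall>l. co t x l = (if l = k then 1 else 0)"
begin

definition gen :: "real \<Rightarrow> 'k \<Rightarrow> 'v" where
  "gen t k = (SOME x. x \<in> carrier (pspace V t) \<and> (\<forall>l. co t x l = (if l = k then 1 else 0)))"

lemma gen:
  assumes "k \<in> K" "t \<in> J k"
  shows gen_closed: "gen t k \<in> carrier (pspace V t)"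
    and co_gen: "co t (gen t k) l = (if l = k then 1 else 0)"
proof -
  have "gen t k \<in> carrier (pspace V t) \<and> (\<forall>l. co t (gen t k) l = (if l = k then 1 else 0))"
    unfolding gen_def by (rule someI_ex) (use co_basis[OF assms] in blast)
  then show "gen t k \<in> carrier (pspace V t)" "co t (gen t k) l = (if l = k then 1 else 0)"
    by simp_all
qed

lemma pmap_gen:
  assumes "k \<in> K" "s \<in> J k" "t \<in> J k" "s \<le> t"
  shows "pmap V t s (gen s k) = gen t k"
  using assms by (intro co_inj[of _ t]) (simp_all add: pmap_closed gen co_pmap)

lemma mem_interval: "k \<in> K \<Longrightarrow> r \<in> J k \<Longrightarrow> t \<in> J k \<Longrightarrow> r \<le> s \<Longrightarrow> s \<le> t \<Longrightarrow> s \<in> J k"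
  using interval mem_is_interval_1_I by blast

end

text \<open>
  A morphism of persistence modules that moves scale \<open>s\<close> to scale \<open>L * s + c\<close>.
\<close>

locale shift_morphism =
  V: interval_coordinates V K J co + W: interval_coordinates W K' J' co'
  for V :: "'v pers_module" and K :: "'k set" and J co
    and W :: "'w pers_module" and K' :: "'l set" and J' co' +
  fixes L c :: real and g :: "real \<Rightarrow> 'v \<Rightarrow> 'w"
  assumes L_pos: "L > 0"
    and closed: "x \<in> carrier (pspace V s) \<Longrightarrow> g s x \<in> carrier (pspace W (L * s + c))"
    and add: "x \<in> carrier (pspace V s) \<Longrightarrow> y \<in> carrier (pspace V s) \<Longrightarrow>
          g s (x \<oplus>\<^bsub>pspace V s\<^esub> y) = g s x \<oplus>\<^bsub>pspace W (L * s + c)\<^esub> g s y"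
    and natural: "s \<le> t \<Longrightarrow> x \<in> carrier (pspace V s) \<Longrightarrow>
          g t (pmap V t s x) = pmap W (L * t + c) (L * s + c) (g s x)"
begin

lemma shift_le_iff: "L * s + c \<le> L * t + c \<longleftrightarrow> s \<le> t"
  using L_pos by simp

text \<open>
  Between two interval modules a morphism is a single scalar.  It can be read off at any scale at
  which both bars are alive, and it is \<open>0\<close> if there is no such scale; independence of the scale
  is \<open>co_gen_eq_entry\<close>.
\<close>

definition entry :: "'l \<Rightarrow> 'k \<Rightarrow> bit" where
  "entry l k = of_bool (k \<in> K \<and> l \<in> K' \<and>
     (\<exists>s. s \<in> J k \<and> L * s + c \<in> J' l \<and> co' (L * s + c) (g s (V.gen s k)) l = 1))"

lemma entryE:
  assumes "entry l k = 1"
  obtains s where "k \<in> K" "l \<in> K'" "s \<in> J k" "L * s + c \<in> J' l"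
    "co' (L * s + c) (g s (V.gen s k)) l = 1"
  using assms unfolding entry_def by (auto simp: of_bool_def split: if_splits)

lemma co_natural:
  assumes "s \<le> t" "x \<in> carrier (pspace V s)"
  shows "co' (L * t + c) (g t (pmap V t s x)) l =
    (if L * t + c \<in> J' l then co' (L * s + c) (g s x) l else 0)"
  using W.co_pmap[OF shift_le_iff[THEN iffD2, OF assms(1)] closed[OF assms(2)]]
  by (simp only: natural[OF assms])

text \<open>
  The generator at an earlier scale maps to the generator at \<open>s\<close>; its image must therefore
  already have the coordinate \<open>l\<close>, since structure maps never create coordinates.
\<close>

lemma target_downward:
  assumes "k \<in> K" "s \<in> J k" "r \<in> J k" "r \<le> s" 
    and "co' (L * s + c) (g s (V.gen s k)) l = 1"
  shows "l \<in> K' \<and> L * r + c \<in> J' l \<and> co' (L * r + c) (g r (V.gen r k)) l = 1"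
proof -
  have "co' (L * s + c) (g s (pmap V s r (V.gen r k))) l = 1"
    using assms by (simp add: V.pmap_gen)
  then have "co' (L * r + c) (g r (V.gen r k)) l = 1"
    using assms V.gen_closed[of k r] by (simp add: co_natural split: if_splits)
  then show ?thesis using W.co_eq_1D closed V.gen_closed assms by blast
qed

text \<open>
  As long as the target bar is alive, the image of the generator keeps its coordinate \<open>l\<close> and
  so cannot be zero; hence the source bar is alive too.
\<close>

lemma source_upward:
  assumes "k \<in> K" "s \<in> J k" "s \<le> t" "L * t + c \<in> J' l"
    and "co' (L * s + c) (g s (V.gen s k)) l = 1"
  shows "t \<in> J k \<and> co' (L * t + c) (g t (V.gen t k)) l = 1"
proof -
  have eq: "co' (L * t + c) (g t (pmap V t s (V.gen s k))) l = 1"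
    using assms V.gen_closed[of k s] by (simp add: co_natural)
  have "t \<in> J k"
  proof (rule ccontr)
    assume t: "t \<notin> J k"
    (* Above its bar the generator becomes zero, that is, an element equal to its double. *)
    define z where "z = pmap V t s (V.gen s k)"
    have z: "z \<in> carrier (pspace V t)"
      unfolding z_def using assms by (simp add: V.pmap_closed V.gen_closed)
    have "co t z m = 0" for m
      unfolding z_def using assms t by (simp add: V.co_pmap V.gen)
    then have "z \<oplus>\<^bsub>pspace V t\<^esub> z = z"
      using z by (intro V.co_inj[of _ t]) (simp_all add: V.add_closed V.co_add)
    then have "co' (L * t + c) (g t z) l = co' (L * t + c) (g t z) l + co' (L * t + c) (g t z) l"
      using add[OF z z] W.co_add[OF closed[OF z] closed[OF z]] by metis
    then show False using eq by (simp add: z_def)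
  qed
  then show ?thesis using eq assms by (simp add: V.pmap_gen)
qed

lemma co_gen_eq_entry:
  assumes k: "k \<in> K" and s: "s \<in> J k" and l: "L * s + c \<in> J' l"
  shows "co' (L * s + c) (g s (V.gen s k)) l = entry l k"
proof (cases "entry l k = 1")
  case True
  then obtain r where r: "r \<in> J k" "l \<in> K'" "L * r + c \<in> J' l"
    "co' (L * r + c) (g r (V.gen r k)) l = 1" by (rule entryE)
  show ?thesis
    using True r source_upward[of k r s l] target_downward[of k r s l] k s l by (cases "r \<le> s") auto
next
  case False
  have "co' (L * s + c) (g s (V.gen s k)) l \<noteq> 1"
  proof
    assume 1: "co' (L * s + c) (g s (V.gen s k)) l = 1"
    then have "l \<in> K'" using W.co_eq_1D[OF closed[OF V.gen_closed[OF k s]]] by blast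
    then have "entry l k = 1" unfolding entry_def of_bool_eq_1_iff using k s l 1 by blast
    then show False using False by simp
  qed
  then show ?thesis using False by (simp only: bit_not_one_iff)
qed

text \<open>
  Morphisms move bars to the left: with a nonzero entry, the target bar starts no later than the
  shifted source bar, and by \<open>hi_le\<close> it also ends no later.
\<close>

lemma lo_le:
  assumes "entry l k = 1"
  shows "lo (J' l) \<le> aff L c (lo (J k))"
proof (rule le_aff_INF[OF L_pos])
  obtain r where r: "k \<in> K" "r \<in> J k" "l \<in> K'" "L * r + c \<in> J' l"
    "co' (L * r + c) (g r (V.gen r k)) l = 1" using assms by (rule entryE)
  fix s assume s: "s \<in> J k"
  show "lo (J' l) \<le> ereal (L * s + c)"
  proof (cases "s \<le> r")
    case True
    then have "L * s + c \<in> J' l" using target_downward[of k r s l] r s by blast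
    then show ?thesis by (rule INF_lower)
  next
    case False
    have "lo (J' l) \<le> ereal (L * r + c)" using r(4) by (rule INF_lower)
    also have "\<dots> \<le> ereal (L * s + c)" using False L_pos by simp
    finally show ?thesis .
  qed
qed

lemma hi_le:
  assumes "entry l k = 1"
  shows "hi (J' l) \<le> aff L c (hi (J k))"
proof (rule SUP_least)
  obtain r where r: "k \<in> K" "r \<in> J k" "l \<in> K'" "L * r + c \<in> J' l"
    "co' (L * r + c) (g r (V.gen r k)) l = 1" using assms by (rule entryE)
  fix u assume u: "u \<in> J' l"
  define s where "s = (u - c) / L"
  have us: "u = L * s + c" using L_pos by (simp add: s_def)
  have "\<exists>t\<in>J k. s \<le> t"
  proof (cases "r \<le> s")
    case True
    then have "s \<in> J k" using source_upward[of k r s l] r u us by blast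
    then show ?thesis by blast
  next
    case False
    then show ?thesis using r(2) by (intro bexI[of _ r]) auto
  qed
  then obtain t where t: "t \<in> J k" "s \<le> t" by blast
  then have "ereal s \<le> hi (J k)" by (meson SUP_upper2 ereal_less_eq(3))
  then have "aff L c (ereal s) \<le> aff L c (hi (J k))" by (simp only: aff_le_iff[OF L_pos])
  then show "ereal u \<le> aff L c (hi (J k))" by (simp add: us)
qed

text \<open>
  Matrix multiplication by \<open>entry\<close>, by induction on the number of nonzero coordinates
  of \<open>x\<close>: adding the generator of one of them removes it, as \<open>1 + 1 = 0\<close>.
\<close>

lemma co_expand:
  assumes "x \<in> carrier (pspace V s)" "L * s + c \<in> J' l"
  shows "co' (L * s + c) (g s x) l = (\<Sum>k | co s x k = 1. entry l k)"
  using assms(1)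
proof (induction "card {k. co s x k = 1}" arbitrary: x)
  case 0
  then have "{k. co s x k = 1} = {}" using V.co_finite by simp
  then have zero: "co s x k = 0" for k using bit_not_one_iff[of "co s x k"] by blast
  then have "x \<oplus>\<^bsub>pspace V s\<^esub> x = x"
    using 0 by (intro V.co_inj[of _ s]) (simp_all add: V.add_closed V.co_add zero)
  then have "co' (L * s + c) (g s x) l = co' (L * s + c) (g s x) l + co' (L * s + c) (g s x) l"
    using add W.co_add closed 0 by metis
  then show ?case using \<open>{k. co s x k = 1} = {}\<close> by (simp add: bit_add_self)
next
  case (Suc n)
  then obtain k where k: "co s x k = 1" by fastforce
  have kJ: "k \<in> K" "s \<in> J k" using V.co_eq_1D[OF Suc.prems k] by auto
  note gk = V.gen_closed[OF kJ]
  define y where "y = x \<oplus>\<^bsub>pspace V s\<^esub> V.gen s k"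
  have y: "y \<in> carrier (pspace V s)" unfolding y_def using Suc.prems gk by (rule V.add_closed)
  have coy: "co s y m = (if m = k then 0 else co s x m)" for m
    unfolding y_def using Suc.prems gk kJ k by (simp add: V.co_add V.co_gen)
  have x: "x = y \<oplus>\<^bsub>pspace V s\<^esub> V.gen s k"
    using y gk Suc.prems k kJ
    by (intro V.co_inj[of _ s]) (auto simp: V.add_closed V.co_add coy V.co_gen)
  have fin: "finite {m. co s y m = 1}" using V.co_finite y by blast
  have ins: "{m. co s x m = 1} = insert k {m. co s y m = 1}" "k \<notin> {m. co s y m = 1}"
    using k by (auto simp: coy)
  have "co' (L * s + c) (g s x) l = co' (L * s + c) (g s y) l + co' (L * s + c) (g s (V.gen s k)) l"
    using x add[OF y gk] W.co_add[OF closed[OF y] closed[OF gk]] by metis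
  also have "co' (L * s + c) (g s (V.gen s k)) l = entry l k"
    using kJ assms(2) by (rule co_gen_eq_entry)
  also have "co' (L * s + c) (g s y) l = (\<Sum>m | co s y m = 1. entry l m)"
    using Suc.hyps(2) ins fin y by (intro Suc.hyps(1)) simp_all
  finally show ?case using ins fin by (simp add: add.commute)
qed

end

section \<open>Matching the bars of a shifted retract\<close>

text \<open>
  The module \<open>V\<close> is a retract of \<open>W\<close> up to a shift: going to \<open>W\<close> and back is the
  structure map of \<open>V\<close> between the scales \<open>s\<close> and \<open>slope * s + offset\<close>.
  The hypothesis on \<open>s\<close> in \<open>retract\<close> singles out the scales at which such a structure
  map exists.
\<close>

locale interval_retract =
  G: shift_morphism V K J co W K' J' co' L c g +
  F: shift_morphism W K' J' co' V K J co L c' f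
  for V :: "'v pers_module" and K :: "'k set" and J co
    and W :: "'w pers_module" and K' :: "'l set" and J' co' and L c c' :: real and g f +
  assumes L_ge_1: "L \<ge> 1" and c_nonneg: "c \<ge> 0" "c' \<ge> 0"
    and retract: "s \<le> L * (L * s + c) + c' \<Longrightarrow> x \<in> carrier (pspace V s) \<Longrightarrow>
      f (L * s + c) (g s x) = pmap V (L * (L * s + c) + c') s x"
    and finite_K: "finite K"
    and J_nonneg: "k \<in> K \<Longrightarrow> J k \<subseteq> {0..}"
begin

abbreviation slope :: real where "slope \<equiv> L * L"
abbreviation offset :: real where "offset \<equiv> L * c + c'"

lemma aff_aff: "aff L c' (aff L c x) = aff slope offset x"
  using G.L_pos by (cases x) (auto simp: algebra_simps)

lemma shift_nonneg: "0 \<le> s \<Longrightarrow> s \<le> L * (L * s + c) + c'"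
proof -
  assume s: "0 \<le> s"
  then have "s \<le> L * s + c" using mult_right_mono[of 1 L s] L_ge_1 c_nonneg by simp
  then show ?thesis using mult_right_mono[of 1 L "L * s + c"] L_ge_1 c_nonneg s by simp
qed

text \<open>
  If \<open>g\<close> has a nonzero entry from bar \<open>k\<close> to bar \<open>l\<close> and \<open>f\<close> one from \<open>l\<close>
  to \<open>k'\<close>, then \<open>l\<close> is alive halfway whenever \<open>k\<close> and \<open>k'\<close> are alive at
  the two ends.  So no term of the matrix product is lost by evaluating it at one scale.
\<close>

lemma middle_mem:
  assumes g: "G.entry l k = 1" and f: "F.entry k' l = 1"
    and s: "s \<in> J k" "L * (L * s + c) + c' \<in> J k'"
  shows "L * s + c \<in> J' l"
proof -
  obtain r where r: "k \<in> K" "r \<in> J k" "l \<in> K'" "L * r + c \<in> J' l"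
    "co' (L * r + c) (g r (G.V.gen r k)) l = 1" using g by (rule G.entryE)
  obtain t where t: "t \<in> J' l" "L * t + c' \<in> J k'"
    "co (L * t + c') (f t (G.W.gen t l)) k' = 1" using f by (rule F.entryE)
  (* Below the scale that witnesses the entry of g, and above the one that witnesses the entry of f,
     l is alive by propagation; in between, because its bar is an interval. *)
  consider "s \<le> r" | "t \<le> L * s + c" | "r \<le> s" "L * s + c \<le> t" by linarith
  then show ?thesis
  proof cases
    case 1
    then show ?thesis using G.target_downward[of k r s l] r s by blast
  next
    case 2
    then show ?thesis using F.source_upward[of l t "L * s + c" k'] r t s by blast
  next
    case 3
    then show ?thesis using G.W.mem_interval[of l "L * r + c" t "L * s + c"] r t G.shift_le_iff by blast
  qed
qed

text \<open>
  Composing two nonzero morphisms of interval modules gives zero exactly if no scale sees both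
  outer bars.  The hypothesis that \<open>k'\<close> outlives the shifted birth of \<open>k\<close> excludes this.
\<close>

lemma exists_common_scale:
  assumes g: "G.entry l k = 1" and f: "F.entry k' l = 1"
    and overlap: "\<not> hi (J k') \<le> aff slope offset (lo (J k))"
  shows "\<exists>s\<in>J k. L * (L * s + c) + c' \<in> J k'"
proof -
  obtain r where r: "k \<in> K" "r \<in> J k" "l \<in> K'" "L * r + c \<in> J' l"
    "co' (L * r + c) (g r (G.V.gen r k)) l = 1" using g by (rule G.entryE)
  obtain t where t: "t \<in> J' l" "k' \<in> K" "L * t + c' \<in> J k'"
    "co (L * t + c') (f t (G.W.gen t l)) k' = 1" using f by (rule F.entryE)
  show ?thesis
  proof (cases "L * r + c \<le> t")
    case True
    then show ?thesis using F.target_downward[of l t "L * r + c" k'] r t by blast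
  next
    case False
    then have tr: "L * t + c' < L * (L * r + c) + c'" using G.L_pos by simp
    (* The scale u of k' is pulled back to the scale s of k with round trip u; if this overshoots r,
       the round trip of r itself lies in the bar of k'. *)
    obtain u where u: "u \<in> J k'" "aff slope offset (lo (J k)) < ereal u"
      using overlap by (auto simp: not_le less_SUP_iff)
    show ?thesis
    proof (cases "u \<le> L * (L * r + c) + c'")
      case False
      then show ?thesis using G.V.mem_interval[of k' "L * t + c'" u] t u tr r by (meson less_imp_le not_le)
    next
      case True
      define s where "s = ((u - c') / L - c) / L"
      have us: "u = L * (L * s + c) + c'" using G.L_pos by (simp add: s_def)
      have sr: "s \<le> r" using True G.L_pos unfolding us by simp
      have "aff slope offset (lo (J k)) < aff slope offset (ereal s)"
        using u(2) by (simp add: us algebra_simps)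
      then have "lo (J k) < ereal s" using G.L_pos by (subst (asm) aff_less_iff) simp
      then obtain v where "v \<in> J k" "v < s" by (auto simp: INF_less_iff)
      then have "s \<in> J k" using G.V.mem_interval[of k v r s] r sr by simp
      then show ?thesis using u us by auto
    qed
  qed
qed

lemma supp_eq_entry:
  assumes "k \<in> K" "s \<in> J k"
  shows "{l. co' (L * s + c) (g s (G.V.gen s k)) l = 1} = {l. L * s + c \<in> J' l \<and> G.entry l k = 1}"
proof (intro Collect_cong iffI)
  fix l assume l: "co' (L * s + c) (g s (G.V.gen s k)) l = 1"
  then have "L * s + c \<in> J' l"
    using G.W.co_eq_1D[OF G.closed[OF G.V.gen_closed[OF assms]]] by blast
  then show "L * s + c \<in> J' l \<and> G.entry l k = 1" using l G.co_gen_eq_entry[OF assms] by simp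
qed (use G.co_gen_eq_entry[OF assms] in simp)

lemma finite_entries:
  assumes "k \<in> K" and s: "s \<in> J k" "L * (L * s + c) + c' \<in> J k'"
  shows "finite {l. G.entry l k = 1 \<and> F.entry k' l = 1}"
proof (rule finite_subset)
  show "{l. G.entry l k = 1 \<and> F.entry k' l = 1} \<subseteq> {l. co' (L * s + c) (g s (G.V.gen s k)) l = 1}"
    unfolding supp_eq_entry[OF assms(1) s(1)] using middle_mem s by blast
  show "finite {l. co' (L * s + c) (g s (G.V.gen s k)) l = 1}"
    using assms by (intro G.W.co_finite G.closed G.V.gen_closed)
qed

text \<open>
  The retraction property in coordinates: wherever a common scale exists, the product of the two
  matrices is the identity.  The sum may run over any finite set containing the nonzero
  terms, which is how it is later restricted to the bars close to a given family.
\<close>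

lemma matrix_product:
  assumes "k \<in> K" and s: "s \<in> J k" "L * (L * s + c) + c' \<in> J k'"
    and N: "finite N" "{l. G.entry l k = 1 \<and> F.entry k' l = 1} \<subseteq> N"
  shows "(\<Sum>l\<in>N. F.entry k' l * G.entry l k) = of_bool (k' = k)"
proof -
  let ?supp = "{l. co' (L * s + c) (g s (G.V.gen s k)) l = 1}"
  have gen: "G.V.gen s k \<in> carrier (pspace V s)" using assms by (intro G.V.gen_closed)
  have fin: "finite ?supp" using gen by (intro G.W.co_finite G.closed)
  have le: "s \<le> L * (L * s + c) + c'" using shift_nonneg J_nonneg assms by (meson atLeast_iff subsetD)
  have zero: "F.entry k' l * G.entry l k = 0" if "\<not> (G.entry l k = 1 \<and> F.entry k' l = 1)" for l
    using that bit_not_one_iff by auto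
  have "(\<Sum>l\<in>N. F.entry k' l * G.entry l k)
      = (\<Sum>l | G.entry l k = 1 \<and> F.entry k' l = 1. F.entry k' l * G.entry l k)"
    using N zero by (intro sum.mono_neutral_right) auto
  also have "\<dots> = (\<Sum>l\<in>?supp. F.entry k' l * G.entry l k)"
  proof (intro sum.mono_neutral_left fin)
    show "{l. G.entry l k = 1 \<and> F.entry k' l = 1} \<subseteq> ?supp"
      unfolding supp_eq_entry[OF assms(1) s(1)] using middle_mem s by blast
  qed (use zero in blast)
  also have "\<dots> = (\<Sum>l\<in>?supp. F.entry k' l)"
    by (intro sum.cong refl) (simp add: supp_eq_entry[OF assms(1) s(1)])
  also have "\<dots> = co (L * (L * s + c) + c') (f (L * s + c) (g s (G.V.gen s k))) k'"
    using F.co_expand[OF G.closed[OF gen] s(2)] by simp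
  also have "\<dots> = co s (G.V.gen s k) k'"
    unfolding retract[OF le gen] using G.V.co_pmap[OF le gen] s(2) by simp
  also have "\<dots> = of_bool (k' = k)" using assms by (simp add: G.V.co_gen)
  finally show ?thesis .
qed

text \<open>
  The endpoint estimate of the matching.  The second and fourth conditions are lower bounds on the
  endpoints of \<open>l\<close>, written with the shift back to \<open>V\<close> instead of its inverse.
\<close>

definition compatible :: "'k \<Rightarrow> 'l \<Rightarrow> bool" where
  "compatible k l \<longleftrightarrow>
     lo (J' l) \<le> aff L c (lo (J k)) \<and> lo (J k) \<le> aff L c' (lo (J' l)) \<and>
     hi (J' l) \<le> aff L c (hi (J k)) \<and> hi (J k) \<le> aff L c' (hi (J' l))"

text \<open>
  The two nonzero entries give all four inequalities of compatibility if two of them are taken for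
  \<open>k\<close> and the other two for \<open>k'\<close>.  If \<open>l\<close> is compatible with neither bar, one
  endpoint of \<open>l\<close> lies too far left for \<open>k\<close> and one endpoint lies too far right for
  \<open>k'\<close>.  The four choices of these endpoints lead to the first three alternatives of
  \<open>obstructed\<close>.
\<close>

lemma compatible_if_not_obstructed:
  assumes g: "G.entry l k = 1" and f: "F.entry k' l = 1"
    and "\<not> obstructed slope offset (lo (J k), hi (J k)) (lo (J k'), hi (J k'))"
  shows "compatible k l \<or> compatible k' l"
proof (rule ccontr)
  let ?a = "lo (J k)" and ?b = "hi (J k)" and ?a' = "lo (J k')" and ?b' = "hi (J k')"
    and ?c = "lo (J' l)" and ?d = "hi (J' l)"
  assume not: "\<not> (compatible k l \<or> compatible k' l)"
  have gc: "?c \<le> aff L c ?a" and gd: "?d \<le> aff L c ?b" using G.lo_le[OF g] G.hi_le[OF g] .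
  have fa: "?a' \<le> aff L c' ?c" and fb: "?b' \<le> aff L c' ?d" using F.lo_le[OF f] F.hi_le[OF f] .
  have strict: "u < v" if "aff L c u < w" "w \<le> aff L c v" for u v w
    using less_le_trans[OF that] unfolding aff_less_iff[OF G.L_pos] .
  have shift: "aff slope offset u < v" if "aff L c u < w" "aff L c' w < v" for u v w
  proof -
    have "aff L c' (aff L c u) < aff L c' w" using that(1) by (simp only: aff_less_iff[OF G.L_pos])
    then show ?thesis using that(2) unfolding aff_aff by (rule less_trans)
  qed
  have upper: "u \<le> aff slope offset v" if "u \<le> aff L c' w" "w \<le> aff L c v" for u v w
  proof -
    have "aff L c' w \<le> aff L c' (aff L c v)" using that(2) by (simp only: aff_le_iff[OF G.L_pos])
    with that(1) show ?thesis unfolding aff_aff by (rule order_trans)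
  qed
  have "aff L c' ?c < ?a \<or> aff L c' ?d < ?b"
    using not gc gd unfolding compatible_def by auto
  moreover have "aff L c ?a' < ?c \<or> aff L c ?b' < ?d"
    using not fa fb unfolding compatible_def by auto
  ultimately have "?a' < ?a \<and> ?b' < ?b \<or> aff slope offset ?a' < ?a \<and> ?b' \<le> aff slope offset ?b \<or>
      aff slope offset ?b' < ?b \<and> ?a' \<le> aff slope offset ?a"
    using strict[OF _ gc] strict[OF _ gd] shift upper[OF fa gc] upper[OF fb gd]
      le_less_trans[OF fa] le_less_trans[OF fb] by blast
  then show False using assms(3) unfolding obstructed_def by blast
qed

definition long :: "'k set" where
  "long = {k \<in> K. aff slope offset (lo (J k)) < hi (J k)}"

text \<open>
  Hall's condition is verified by column independence.  Given a nonempty set \<open>U\<close> of long bars,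
  choose \<open>k'\<close> in \<open>U\<close> that is unobstructed from all bars of \<open>U\<close>.  Then the row \<open>k'\<close>
  of the product of the two matrices, restricted to \<open>U\<close>, is a row of the identity matrix, and
  only bars compatible with a member of \<open>U\<close> contribute to it.  Hence the sum of the columns
  in \<open>U\<close> has a nonzero coordinate at one of these bars.
\<close>

theorem matching:
  "\<exists>m. inj_on m long \<and> (\<forall>k\<in>long. m k \<in> K' \<and> compatible k (m k))"
proof -
  let ?obs = "\<lambda>k k'. obstructed slope offset (lo (J k), hi (J k)) (lo (J k'), hi (J k'))"
  let ?E = "\<lambda>k k'. {l. G.entry l k = 1 \<and> F.entry k' l = 1}"
  have long: "k \<in> K" "aff slope offset (lo (J k)) < hi (J k)" if "k \<in> long" for k
    using that by (auto simp: long_def)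
  have M1: "slope \<ge> 1" using mult_mono[of 1 L 1 L] L_ge_1 by simp
  have C0: "offset \<ge> 0" using L_ge_1 c_nonneg by simp
  have scale: "?E k k' = {} \<or> (\<exists>s\<in>J k. L * (L * s + c) + c' \<in> J k')" if "\<not> ?obs k k'" for k k'
    using exists_common_scale[of _ k k'] that unfolding obstructed_def by blast
  have finE: "finite (?E k k')" if k: "k \<in> long" "\<not> ?obs k k'" for k k'
  proof (cases "?E k k' = {}")
    case True
    then show ?thesis by (simp only: finite.emptyI)
  next
    case False
    then obtain s where "s \<in> J k" "L * (L * s + c) + c' \<in> J k'" using scale[OF k(2)] by blast
    then show ?thesis using finite_entries[of k s k'] long(1)[OF k(1)] by blast
  qed
  (* A bar may have infinitely many compatible partners.  The finitely many ones that carry a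
     nonzero term of some relevant product suffice, and make the neighbourhoods finite. *)
  define N where "N = (\<Union>k\<in>long. \<Union>k'\<in>{k' \<in> long. \<not> ?obs k k'}. ?E k k')"
  have "finite long" using finite_K by (simp add: long_def)
  then have finN: "finite N" unfolding N_def using finE by (intro finite_UN_I) auto
  have NK: "N \<subseteq> K'" unfolding N_def by (auto elim: G.entryE)
  have prod: "(\<Sum>l\<in>B. F.entry k' l * G.entry l k) = of_bool (k' = k)"
    if k: "k \<in> long" "k' \<in> long" "\<not> ?obs k k'"
      and B: "finite B" "?E k k' \<subseteq> B" for k k' B
  proof (cases "\<exists>s\<in>J k. L * (L * s + c) + c' \<in> J k'")
    case True
    then show ?thesis using matrix_product[of k _ k' B] long(1)[OF k(1)] B by blast
  next
    case False
    then have "?E k k' = {}" using scale k by blast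
    then have "F.entry k' l * G.entry l k = 0" for l
      using bit_not_one_iff[of "F.entry k' l"] bit_not_one_iff[of "G.entry l k"] by auto
    moreover have "k' \<noteq> k"
    proof
      assume eq: "k' = k"
      obtain u where u: "u \<in> J k" "aff slope offset (lo (J k)) < ereal u"
        using long[OF k(1)] by (auto simp: less_SUP_iff)
      define s where "s = ((u - c') / L - c) / L"
      have us: "u = L * (L * s + c) + c'" using G.L_pos by (simp add: s_def)
      have "aff slope offset (lo (J k)) < aff slope offset (ereal s)"
        using u(2) by (simp add: us algebra_simps)
      then have "lo (J k) < ereal s" using G.L_pos by (subst (asm) aff_less_iff) simp
      then obtain v where v: "v \<in> J k" "v < s" by (auto simp: INF_less_iff)
      then have "0 \<le> s" using J_nonneg[OF long(1)[OF k(1)]] by force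
      then have "s \<le> u" using shift_nonneg us by blast
      then have "s \<in> J k" using G.V.mem_interval[of k v u s] v u long(1)[OF k(1)] by simp
      then show False using False eq u us by auto
    qed
    ultimately show ?thesis by (simp only: sum.neutral_const of_bool_eq simp_thms)
  qed
  have "\<exists>m. inj_on m long \<and> (\<forall>k\<in>long. m k \<in> {l \<in> N. compatible k l})"
  proof (rule hall_matching[OF \<open>finite long\<close>])
    show "finite {l \<in> N. compatible k l}" for k using finN by simp
    fix A assume A: "A \<subseteq> long"
    let ?B = "\<Union>k\<in>A. {l \<in> N. compatible k l}"
    have finA: "finite A" using A \<open>finite long\<close> finite_subset by blast
    have finB: "finite ?B" using finN by (rule finite_subset[rotated]) blast
    show "card A \<le> card ?B"
    proof (rule card_le_card_if_columns_independent[OF finA finB, of G.entry])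
      fix U assume U: "U \<subseteq> A" "U \<noteq> {}"
      have U_long: "k \<in> long" if "k \<in> U" for k using that U A by blast
      have "\<exists>k'\<in>U. \<forall>k\<in>U. \<not> ?obs k k'"
      proof (rule exists_unobstructed[OF M1 C0 finite_subset[OF U(1) finA] U(2)])
        show "0 \<le> lo (J k)" if "k \<in> U" for k
          using J_nonneg[OF long(1)[OF U_long[OF that]]] by (intro INF_greatest) auto
      qed (use long U_long in blast)
      then obtain k' where k': "k' \<in> U" and unobs: "\<And>k. k \<in> U \<Longrightarrow> \<not> ?obs k k'" by blast
      show "\<exists>l\<in>?B. (\<Sum>k\<in>U. G.entry l k) \<noteq> 0"
      proof (rule ccontr)
        assume "\<not> ?thesis"
        then have zero: "(\<Sum>k\<in>U. G.entry l k) = 0" if "l \<in> ?B" for l using that by blast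
        have "(\<Sum>l\<in>?B. F.entry k' l * (\<Sum>k\<in>U. G.entry l k)) = 0"
          by (intro sum.neutral ballI) (simp only: zero mult_zero_right)
        moreover have "(\<Sum>l\<in>?B. F.entry k' l * (\<Sum>k\<in>U. G.entry l k))
            = (\<Sum>k\<in>U. \<Sum>l\<in>?B. F.entry k' l * G.entry l k)"
          by (simp only: sum_distrib_left) (rule sum.swap)
        moreover have "\<dots> = (\<Sum>k\<in>U. of_bool (k' = k))"
        proof (intro sum.cong refl prod)
          fix k assume k: "k \<in> U"
          show "?E k k' \<subseteq> ?B"
          proof
            fix l assume l: "l \<in> ?E k k'"
            then have "l \<in> N" unfolding N_def using k k' U_long unobs by blast
            moreover have "compatible k l \<or> compatible k' l"
              using l unobs[OF k] compatible_if_not_obstructed[of l k k'] by blast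
            ultimately show "l \<in> ?B" using k k' U by blast
          qed
        qed (use U_long k' unobs finB in auto)
        moreover have "\<dots> = (1 :: bit)"
          using k' finite_subset[OF U(1) finA] by (simp add: of_bool_def sum.delta')
        ultimately show False by simp
      qed
    qed
  qed
  then show ?thesis using NK by blast
qed

end

section \<open>Coordinates from an interval decomposition\<close>

lemma interval_coordinates_of_decomposition:
  assumes dec: "interval_decomposition V K J"
    and add_closed: "\<And>t x y. x \<in> carrier (pspace V t) \<Longrightarrow> y \<in> carrier (pspace V t) \<Longrightarrow>
          x \<oplus>\<^bsub>pspace V t\<^esub> y \<in> carrier (pspace V t)"
    and pmap_closed: "\<And>s t x. s \<le> t \<Longrightarrow> x \<in> carrier (pspace V s) \<Longrightarrow>
          pmap V t s x \<in> carrier (pspace V t)"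
  shows "\<exists>co. interval_coordinates V K J co"
proof -
  let ?D = "direct_sum K (\<lambda>k. interval_module (J k))"
  obtain \<psi> where iso: "\<And>t. linear_iso (pspace V t) (pspace ?D t) (\<psi> t)"
    and nat: "\<And>s t x. s \<le> t \<Longrightarrow> x \<in> carrier (pspace V s) \<Longrightarrow> \<psi> t (pmap V t s x) = pmap ?D t s (\<psi> s x)"
    using dec unfolding interval_decomposition_def pm_isomorphic_def by blast
  have carrier_D: "carrier (pspace ?D t) =
      {x \<in> \<Pi>\<^sub>E k\<in>K. (if t \<in> J k then UNIV else {0}). finite {k \<in> K. x k \<noteq> 0}}" for t
    by (simp add: direct_sum_def interval_module_def)
  have add_D: "x \<oplus>\<^bsub>pspace ?D t\<^esub> y = (\<lambda>k\<in>K. x k + y k)" for t x y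
    by (simp add: direct_sum_def interval_module_def)
  have pmap_D: "pmap ?D t s x = (\<lambda>k\<in>K. if s \<in> J k \<and> t \<in> J k then x k else 0)" for s t x
    by (simp add: direct_sum_def interval_module_def)
  (* Elements of the direct sum are undefined outside K. *)
  define co where "co t x k = (if k \<in> K then \<psi> t x k else 0)" for t x k
  have bij: "bij_betw (\<psi> t) (carrier (pspace V t)) (carrier (pspace ?D t))" for t
    using iso unfolding linear_iso_def by blast
  have closed: "\<psi> t x \<in> carrier (pspace ?D t)" if "x \<in> carrier (pspace V t)" for t x
    using bij_betwE[OF bij] that by blast
  have outside: "\<psi> t x k = 0" if "x \<in> carrier (pspace V t)" "k \<in> K" "t \<notin> J k" for t x k
    using PiE_mem[of "\<psi> t x" K "\<lambda>k. if t \<in> J k then UNIV else {0}" k] closed[OF that(1)] that(2,3)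
    unfolding carrier_D by simp
  have "interval_coordinates V K J co"
  proof
    show "is_interval (J k)" if "k \<in> K" for k
      using dec that unfolding interval_decomposition_def by blast
    show "k \<in> K \<and> t \<in> J k" if "x \<in> carrier (pspace V t)" "co t x k = 1" for x t k
      using outside[OF that(1), of k] that(2) by (auto simp: co_def split: if_splits)
    show "finite {k. co t x k = 1}" if "x \<in> carrier (pspace V t)" for x t
    proof (rule finite_subset)
      show "{k. co t x k = 1} \<subseteq> {k \<in> K. \<psi> t x k \<noteq> 0}" by (auto simp: co_def split: if_splits)
      show "finite {k \<in> K. \<psi> t x k \<noteq> 0}" using closed[OF that] unfolding carrier_D by blast
    qed
    show "co t (x \<oplus>\<^bsub>pspace V t\<^esub> y) k = co t x k + co t y k"
      if "x \<in> carrier (pspace V t)" "y \<in> carrier (pspace V t)" for x y t k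
    proof -
      have "\<psi> t (x \<oplus>\<^bsub>pspace V t\<^esub> y) = \<psi> t x \<oplus>\<^bsub>pspace ?D t\<^esub> \<psi> t y"
        using iso that unfolding linear_iso_def linear_map_def by blast
      then show ?thesis unfolding add_D by (simp add: co_def)
    qed
    show "co t (pmap V t s x) k = (if t \<in> J k then co s x k else 0)"
      if "s \<le> t" "x \<in> carrier (pspace V s)" for s t x k
      using nat[OF that] outside[OF that(2), of k] unfolding pmap_D by (auto simp: co_def)
    show "x = y" if xy: "x \<in> carrier (pspace V t)" "y \<in> carrier (pspace V t)"
      and eq: "\<And>k. co t x k = co t y k" for x y t
    proof -
      have "\<psi> t x = \<psi> t y"
      proof
        fix k
        show "\<psi> t x k = \<psi> t y k"
        proof (cases "k \<in> K")
          case True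
          then show ?thesis using eq[of k] by (simp add: co_def)
        next
          case False
          have "\<psi> t x \<in> extensional K" "\<psi> t y \<in> extensional K"
            using closed[OF xy(1)] closed[OF xy(2)] unfolding carrier_D PiE_def by blast+
          then show ?thesis using False by (simp add: extensional_def)
        qed
      qed
      then show ?thesis using bij_betw_imp_inj_on[OF bij] xy by (meson inj_onD)
    qed
    show "\<exists>x\<in>carrier (pspace V t). \<forall>l. co t x l = (if l = k then 1 else 0)"
      if "k \<in> K" "t \<in> J k" for k t
    proof -
      let ?e = "\<lambda>l\<in>K. if l = k then 1 else 0 :: bit"
      have "finite {l \<in> K. ?e l \<noteq> 0}" by (rule finite_subset[of _ "{k}"]) auto
      then have "?e \<in> carrier (pspace ?D t)" unfolding carrier_D using that by auto
      then obtain x where "x \<in> carrier (pspace V t)" "\<psi> t x = ?e"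
        using bij_betw_imp_surj_on[OF bij] by (metis imageE)
      then show ?thesis using that by (intro bexI[of _ x]) (auto simp: co_def)
    qed
  qed (use add_closed pmap_closed in auto)
  then show ?thesis by blast
qed

section \<open>Maps induced on Rips homology\<close>

lemma boundary_superset:
  assumes "finite T" "Poly_Mapping.keys c \<subseteq> T" "p \<noteq> 0"
  shows "boundary p c = (\<Sum>\<sigma>\<in>T. \<Sum>i=0..p.
     Poly_Mapping.single (face i \<sigma>) ((-1) ^ i * Poly_Mapping.lookup c \<sigma>))"
  unfolding boundary_def if_not_P[OF assms(3)] using assms(1,2)
  by (intro sum.mono_neutral_left) (auto simp: in_keys_iff)

lemma boundary_add: "boundary p (c + d) = boundary p c + boundary p d"
proof (cases "p = 0")
  case False
  let ?T = "Poly_Mapping.keys c \<union> Poly_Mapping.keys d"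
  show ?thesis
    using False Poly_Mapping.keys_add[of c d]
    by (simp add: boundary_superset[of ?T] lookup_add algebra_simps single_add sum.distrib)
qed (simp add: boundary_def)

lemma boundary_single: "p \<noteq> 0 \<Longrightarrow>
  boundary p (Poly_Mapping.single \<sigma> b) = (\<Sum>i=0..p. Poly_Mapping.single (face i \<sigma>) ((-1) ^ i * b))"
  by (subst boundary_superset[of "{\<sigma>}"]) auto

text \<open>
  The chain map induced by a map of vertices.
\<close>

definition push :: "('a \<Rightarrow> 'b) \<Rightarrow> ('a list \<Rightarrow>\<^sub>0 bit) \<Rightarrow> ('b list \<Rightarrow>\<^sub>0 bit)" where
  "push F c = (\<Sum>\<sigma>\<in>Poly_Mapping.keys c. Poly_Mapping.single (map F \<sigma>) (Poly_Mapping.lookup c \<sigma>))"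

lemma push_superset:
  assumes "finite T" "Poly_Mapping.keys c \<subseteq> T"
  shows "push F c = (\<Sum>\<sigma>\<in>T. Poly_Mapping.single (map F \<sigma>) (Poly_Mapping.lookup c \<sigma>))"
  unfolding push_def using assms
  by (intro sum.mono_neutral_left) (auto simp: in_keys_iff)

lemma push_add: "push F (c + d) = push F c + push F d"
proof -
  let ?T = "Poly_Mapping.keys c \<union> Poly_Mapping.keys d"
  show ?thesis
    using Poly_Mapping.keys_add[of c d]
    by (simp add: push_superset[of ?T] lookup_add single_add sum.distrib)
qed

lemma push_single: "push F (Poly_Mapping.single \<sigma> b) = Poly_Mapping.single (map F \<sigma>) b"
  by (subst push_superset[of "{\<sigma>}"]) auto

lemma push_0 [simp]: "push F 0 = 0"
  by (simp add: push_def)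

lemma boundary_0 [simp]: "boundary p 0 = 0"
  by (simp add: boundary_def)

lemma push_sum: "push F (\<Sum>x\<in>A. c x) = (\<Sum>x\<in>A. push F (c x))"
  by (induction A rule: infinite_finite_induct) (simp_all add: push_add)

lemma face_map: "face i (map F \<sigma>) = map F (face i \<sigma>)"
  by (simp add: face_def take_map drop_map)

lemma chain_induct [consumes 1, case_names zero add]:
  fixes c :: "'a list \<Rightarrow>\<^sub>0 bit"
  assumes "Poly_Mapping.keys c \<subseteq> S"
    and "P 0"
    and "\<And>\<sigma> b c. \<sigma> \<in> S \<Longrightarrow> Poly_Mapping.keys c \<subseteq> S \<Longrightarrow> P c \<Longrightarrow> P (Poly_Mapping.single \<sigma> b + c)"
  shows "P c"
  using assms(1)
proof (induction "card (Poly_Mapping.keys c)" arbitrary: c)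
  case 0
  then have "c = 0" by simp
  then show ?case using assms(2) by simp
next
  case (Suc n)
  then obtain \<sigma> where \<sigma>: "\<sigma> \<in> Poly_Mapping.keys c" by fastforce
  define d where "d = c - Poly_Mapping.single \<sigma> (Poly_Mapping.lookup c \<sigma>)"
  have keys_d: "Poly_Mapping.keys d = Poly_Mapping.keys c - {\<sigma>}"
  proof -
    have "Poly_Mapping.lookup d \<tau> = (if \<tau> = \<sigma> then 0 else Poly_Mapping.lookup c \<tau>)" for \<tau>
      by (simp add: d_def lookup_minus lookup_single when_def bit_add_self)
    then show ?thesis by (auto simp: in_keys_iff split: if_splits)
  qed
  have "P (Poly_Mapping.single \<sigma> (Poly_Mapping.lookup c \<sigma>) + d)"
    using Suc \<sigma> keys_d by (intro assms(3) Suc.hyps(1)) auto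
  then show ?case by (simp add: d_def)
qed

lemma boundary_push: "boundary p (push F c) = push F (boundary p c)"
proof (cases "p = 0")
  case False
  have "Poly_Mapping.keys c \<subseteq> UNIV" by simp
  then show ?thesis
    by (induction c rule: chain_induct)
      (simp_all add: push_add boundary_add push_single boundary_single False push_sum face_map)
qed (simp add: boundary_def)

lemma push_push_id:
  assumes "\<And>x. x \<in> Y \<Longrightarrow> F (G x) = x" 
    and "Poly_Mapping.keys c \<subseteq> {\<sigma>. set \<sigma> \<subseteq> Y}"
  shows "push F (push G c) = c"
  using assms(2)
proof (induction c rule: chain_induct)
  case (add \<sigma> b c)
  have "map (F \<circ> G) \<sigma> = \<sigma>" using add(1) assms(1) by (intro map_idI) auto
  then show ?case using add by (simp add: push_add push_single)
qed simp

lemma keys_push: "Poly_Mapping.keys (push F c) \<subseteq> map F ` Poly_Mapping.keys c"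
proof -
  have "Poly_Mapping.keys (push F c) \<subseteq> (\<Union>\<sigma>\<in>Poly_Mapping.keys c.
      Poly_Mapping.keys (Poly_Mapping.single (map F \<sigma>) (Poly_Mapping.lookup c \<sigma>)))"
    unfolding push_def by (rule Poly_Mapping.keys_sum)
  then show ?thesis by (auto split: if_splits)
qed

lemma diameter_set_le_iff:
  fixes \<sigma> :: "'a::metric_space list"
  assumes "\<sigma> \<noteq> []"
  shows "diameter (set \<sigma>) \<le> s \<longleftrightarrow> (\<forall>x\<in>set \<sigma>. \<forall>y\<in>set \<sigma>. dist x y \<le> s)"
proof
  show "diameter (set \<sigma>) \<le> s \<Longrightarrow> \<forall>x\<in>set \<sigma>. \<forall>y\<in>set \<sigma>. dist x y \<le> s"
    by (meson List.finite_set diameter_bounded_bound finite_imp_bounded order_trans)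
next
  assume "\<forall>x\<in>set \<sigma>. \<forall>y\<in>set \<sigma>. dist x y \<le> s"
  then show "diameter (set \<sigma>) \<le> s"
    unfolding diameter_def using assms by (auto intro!: cSUP_least)
qed

lemma rips_simplices_iff:
  "\<sigma> \<in> rips_simplices X p s \<longleftrightarrow>
     length \<sigma> = p + 1 \<and> set \<sigma> \<subseteq> X \<and> (\<forall>x\<in>set \<sigma>. \<forall>y\<in>set \<sigma>. dist x y \<le> s)"
  unfolding rips_simplices_def using diameter_set_le_iff[of \<sigma> s] by (cases \<sigma>) auto

lemma rips_simplices_mono: "s \<le> t \<Longrightarrow> rips_simplices X p s \<subseteq> rips_simplices X p t"
  by (auto simp: rips_simplices_def)

lemma carrier_rips_chains: "carrier (rips_chains X p s) = {c. Poly_Mapping.keys c \<subseteq> rips_simplices X p s}"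
  by (simp add: rips_chains_def)

definition rips_class :: "'a::metric_space set \<Rightarrow> nat \<Rightarrow> real \<Rightarrow> ('a list \<Rightarrow>\<^sub>0 bit) \<Rightarrow> ('a list \<Rightarrow>\<^sub>0 bit) set" where
  "rips_class X p s c = (\<lambda>b. b + c) ` rips_boundaries X p s"

lemma boundaries_0: "0 \<in> rips_boundaries X p s"
  unfolding rips_boundaries_def carrier_rips_chains by (rule image_eqI[of _ _ 0]) auto

lemma boundaries_add: 
  assumes "b \<in> rips_boundaries X p s" "b' \<in> rips_boundaries X p s"
  shows "b + b' \<in> rips_boundaries X p s"
proof -
  obtain c c' where c: "b = boundary (Suc p) c" "b' = boundary (Suc p) c'"
    "Poly_Mapping.keys c \<subseteq> rips_simplices X (Suc p) s" "Poly_Mapping.keys c' \<subseteq> rips_simplices X (Suc p) s"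
    using assms unfolding rips_boundaries_def carrier_rips_chains by blast
  have "Poly_Mapping.keys (c + c') \<subseteq> rips_simplices X (Suc p) s"
    using c(3,4) Poly_Mapping.keys_add[of c c'] by blast
  then show ?thesis
    unfolding rips_boundaries_def carrier_rips_chains
    by (intro image_eqI[of _ _ "c + c'"]) (auto simp: boundary_add c)
qed

lemma boundaries_mono: "s \<le> t \<Longrightarrow> rips_boundaries X p s \<subseteq> rips_boundaries X p t"
  unfolding rips_boundaries_def carrier_rips_chains
  using rips_simplices_mono[of s t X "Suc p"] by blast

lemma chain_add_self: "(c :: 'a \<Rightarrow>\<^sub>0 bit) + c = 0"
  by (rule poly_mapping_eqI) (simp only: lookup_add bit_add_self lookup_zero)

lemma rips_class_absorb:
  assumes "c' \<in> rips_class X p s c" "s \<le> t"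
  shows "rips_class X p t c' = rips_class X p t c"
proof -
  obtain b where b: "b \<in> rips_boundaries X p t" "c' = b + c"
    using assms boundaries_mono[of s t X p] unfolding rips_class_def by blast
  have "c = b + c'" using chain_add_self[of b] by (simp add: b add.assoc[symmetric])
  then have "b' + c' = (b' + b) + c" "b' + c = (b' + b) + c'" for b'
    by (simp_all only: b(2) add.assoc)
  then show ?thesis unfolding rips_class_def using boundaries_add[OF _ b(1)] by (auto simp only: image_iff)
qed

lemma rips_class_self: "c \<in> rips_class X p s c"
  unfolding rips_class_def using boundaries_0 by (rule image_eqI[rotated]) simp

lemma cycles_add: "c \<in> rips_cycles X p s \<Longrightarrow> d \<in> rips_cycles X p s \<Longrightarrow> c + d \<in> rips_cycles X p s"
  using Poly_Mapping.keys_add[of c d]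
  by (auto simp: rips_cycles_def carrier_rips_chains boundary_add)

lemma cycles_mono: "s \<le> t \<Longrightarrow> rips_cycles X p s \<subseteq> rips_cycles X p t"
  using rips_simplices_mono[of s t X p] by (auto simp: rips_cycles_def carrier_rips_chains)

lemma carrier_rips_pm: "carrier (pspace (rips_pm p X) s) = rips_class X p s ` rips_cycles X p s"
  unfolding rips_pm_def rips_homology_def quotient_space_def rips_class_def
  by (auto simp: A_RCOSETS_def' a_r_coset_def' rips_chains_def)

lemma add_rips_pm: "rips_class X p s c \<oplus>\<^bsub>pspace (rips_pm p X) s\<^esub> rips_class X p s d = rips_class X p s (c + d)"
proof -
  have "rips_class X p s c \<oplus>\<^bsub>pspace (rips_pm p X) s\<^esub> rips_class X p s d =
      (\<Union>x\<in>rips_class X p s c. \<Union>y\<in>rips_class X p s d. {x + y})"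
    by (simp add: rips_pm_def rips_homology_def quotient_space_def set_add_def' rips_chains_def)
  also have "\<dots> = rips_class X p s (c + d)"
  proof (intro equalityI subsetI)
    fix z assume "z \<in> (\<Union>x\<in>rips_class X p s c. \<Union>y\<in>rips_class X p s d. {x + y})"
    then obtain b b' where b: "b \<in> rips_boundaries X p s" "b' \<in> rips_boundaries X p s" "z = (b + c) + (b' + d)"
      by (auto simp: rips_class_def)
    have "z = (b + b') + (c + d)" unfolding b(3) by (simp add: algebra_simps)
    then show "z \<in> rips_class X p s (c + d)" using boundaries_add[OF b(1,2)] by (auto simp: rips_class_def)
  next
    fix z assume "z \<in> rips_class X p s (c + d)"
    then obtain b where "b \<in> rips_boundaries X p s" "z = (b + c) + d" by (auto simp: rips_class_def add.assoc)
    then have "b + c \<in> rips_class X p s c" "z = (b + c) + d" unfolding rips_class_def by blast+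
    then show "z \<in> (\<Union>x\<in>rips_class X p s c. \<Union>y\<in>rips_class X p s d. {x + y})"
      using rips_class_self[of d X p s] by blast
  qed
  finally show ?thesis .
qed

lemma pmap_rips_pm:
  assumes "s \<le> t"
  shows "pmap (rips_pm p X) t s (rips_class X p s c) = rips_class X p t c"
proof -
  have "pmap (rips_pm p X) t s (rips_class X p s c) = (\<Union>c'\<in>rips_class X p s c. rips_class X p t c')"
    by (auto simp: rips_pm_def a_r_coset_def' rips_chains_def rips_class_def)
  also have "\<dots> = rips_class X p t c"
    using rips_class_absorb[OF _ assms] rips_class_self[of c X p s] by blast
  finally show ?thesis .
qed

lemma rips_pm_add_closed:
  assumes "x \<in> carrier (pspace (rips_pm p X) t)" "y \<in> carrier (pspace (rips_pm p X) t)"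
  shows "x \<oplus>\<^bsub>pspace (rips_pm p X) t\<^esub> y \<in> carrier (pspace (rips_pm p X) t)"
  using assms unfolding carrier_rips_pm by (auto simp: add_rips_pm intro!: imageI cycles_add)

lemma rips_pm_pmap_closed:
  assumes "s \<le> t" "x \<in> carrier (pspace (rips_pm p X) s)"
  shows "pmap (rips_pm p X) t s x \<in> carrier (pspace (rips_pm p X) t)"
  using assms cycles_mono[OF assms(1), of X p] unfolding carrier_rips_pm by (auto simp: pmap_rips_pm intro!: imageI)

text \<open>
  The union over all representatives follows the definition of the structure maps; on a class all
  representatives have the same image, see \<open>induced_rips_class\<close>.
\<close>

definition induced :: "('a \<Rightarrow> 'b) \<Rightarrow> 'b::metric_space set \<Rightarrow> nat \<Rightarrow> real \<Rightarrow> ('a list \<Rightarrow>\<^sub>0 bit) set \<Rightarrow> ('b list \<Rightarrow>\<^sub>0 bit) set" where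
  "induced F Y p t A = (\<Union>c\<in>A. rips_class Y p t (push F c))"

context
  fixes F :: "'a::metric_space \<Rightarrow> 'b::metric_space" and X Y and s t :: real
  assumes maps: "F ` X \<subseteq> Y"
    and scale: "\<And>x y. x \<in> X \<Longrightarrow> y \<in> X \<Longrightarrow> dist x y \<le> s \<Longrightarrow> dist (F x) (F y) \<le> t"
begin

lemma map_rips_simplices: "\<sigma> \<in> rips_simplices X p s \<Longrightarrow> map F \<sigma> \<in> rips_simplices Y p t"
  using maps scale by (auto simp: rips_simplices_iff) blast+

lemma push_chains: "Poly_Mapping.keys c \<subseteq> rips_simplices X p s \<Longrightarrow> Poly_Mapping.keys (push F c) \<subseteq> rips_simplices Y p t"
  using keys_push[of F c] map_rips_simplices by blast

lemma push_cycles: "c \<in> rips_cycles X p s \<Longrightarrow> push F c \<in> rips_cycles Y p t"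
  using push_chains by (simp add: rips_cycles_def carrier_rips_chains boundary_push)

lemma push_boundaries: "b \<in> rips_boundaries X p s \<Longrightarrow> push F b \<in> rips_boundaries Y p t"
  unfolding rips_boundaries_def carrier_rips_chains
  using push_chains by (auto simp flip: boundary_push)

lemma induced_rips_class: "induced F Y p t (rips_class X p s c) = rips_class Y p t (push F c)"
proof -
  have "rips_class Y p t (push F c') = rips_class Y p t (push F c)" if c': "c' \<in> rips_class X p s c" for c'
  proof (rule rips_class_absorb[OF _ order_refl])
    show "push F c' \<in> rips_class Y p t (push F c)"
      using c' push_boundaries by (auto simp: rips_class_def push_add)
  qed
  then show ?thesis unfolding induced_def using rips_class_self[of c X p s] by blast
qed

end

lemma shift_morphism_induced:
  assumes "interval_coordinates (rips_pm p X) K J co" "interval_coordinates (rips_pm p Y) K' J' co'"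
    and "L > 0" and maps: "F ` X \<subseteq> Y"
    and lipschitz: "\<And>x y. x \<in> X \<Longrightarrow> y \<in> X \<Longrightarrow> dist (F x) (F y) \<le> L * dist x y + c"
  shows "shift_morphism (rips_pm p X) K J co (rips_pm p Y) K' J' co' L c (\<lambda>s. induced F Y p (L * s + c))"
proof -
  interpret V: interval_coordinates "rips_pm p X" K J co by fact
  interpret W: interval_coordinates "rips_pm p Y" K' J' co' by fact
  have scale: "dist (F x) (F y) \<le> L * s + c" if "x \<in> X" "y \<in> X" "dist x y \<le> s" for x y s
  proof -
    have "L * dist x y \<le> L * s" using that \<open>L > 0\<close> by (intro mult_left_mono) auto
    then show ?thesis using lipschitz[OF that(1,2)] by linarith
  qed
  note ind = induced_rips_class[OF maps scale]
  note cyc = push_cycles[OF maps scale]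
  show ?thesis
  proof
    show "induced F Y p (L * s + c) x \<in> carrier (pspace (rips_pm p Y) (L * s + c))"
      if "x \<in> carrier (pspace (rips_pm p X) s)" for x s
      using that cyc unfolding carrier_rips_pm by (auto simp: ind)
    show "induced F Y p (L * s + c) (x \<oplus>\<^bsub>pspace (rips_pm p X) s\<^esub> y) =
        induced F Y p (L * s + c) x \<oplus>\<^bsub>pspace (rips_pm p Y) (L * s + c)\<^esub> induced F Y p (L * s + c) y"
      if "x \<in> carrier (pspace (rips_pm p X) s)" "y \<in> carrier (pspace (rips_pm p X) s)" for x y s
      using that unfolding carrier_rips_pm by (auto simp: ind add_rips_pm push_add)
    show "induced F Y p (L * t + c) (pmap (rips_pm p X) t s x) =
        pmap (rips_pm p Y) (L * t + c) (L * s + c) (induced F Y p (L * s + c) x)"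
      if "s \<le> t" "x \<in> carrier (pspace (rips_pm p X) s)" for s t x
    proof -
      have "L * s + c \<le> L * t + c" using that(1) \<open>L > 0\<close> by simp
      note pm = pmap_rips_pm[OF this] pmap_rips_pm[OF that(1)]
      show ?thesis using that(2) unfolding carrier_rips_pm by (auto simp only: ind pm)
    qed
  qed fact
qed

section \<open>Bars of a finite metric space\<close>

lemma finite_chains:
  assumes "finite S"
  shows "finite {c :: 'a \<Rightarrow>\<^sub>0 bit. Poly_Mapping.keys c \<subseteq> S}"
proof (rule inj_on_finite[where B = "Pow S" and f = Poly_Mapping.keys])
  show "inj_on Poly_Mapping.keys {c :: 'a \<Rightarrow>\<^sub>0 bit. Poly_Mapping.keys c \<subseteq> S}"
  proof (rule inj_onI, rule poly_mapping_eqI)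
    fix c d :: "'a \<Rightarrow>\<^sub>0 bit" and \<sigma>
    assume "Poly_Mapping.keys c = Poly_Mapping.keys d"
    then have "Poly_Mapping.lookup c \<sigma> = 0 \<longleftrightarrow> Poly_Mapping.lookup d \<sigma> = 0"
      by (metis in_keys_iff)
    then show "Poly_Mapping.lookup c \<sigma> = Poly_Mapping.lookup d \<sigma>"
      by (cases "Poly_Mapping.lookup c \<sigma>"; cases "Poly_Mapping.lookup d \<sigma>") auto
  qed
qed (use assms in auto)

lemma finite_rips_simplices: "finite X \<Longrightarrow> finite (rips_simplices X p s)"
  by (rule finite_subset[OF _ finite_lists_length_eq[of X "p + 1"]]) (auto simp: rips_simplices_def)

lemma finite_carrier_rips_pm:
  assumes "finite X"
  shows "finite (carrier (pspace (rips_pm p X) t))"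
proof -
  have "rips_cycles X p t \<subseteq> {c. Poly_Mapping.keys c \<subseteq> rips_simplices X p t}"
    by (auto simp: rips_cycles_def carrier_rips_chains)
  then have "finite (rips_cycles X p t)"
    using finite_chains[OF finite_rips_simplices[OF assms]] by (rule finite_subset)
  then show ?thesis by (simp add: carrier_rips_pm)
qed

context
  fixes X :: "'a::metric_space set" and p :: nat and K :: "'k set" and J co
  assumes coords: "interval_coordinates (rips_pm p X) K J co"
begin

interpretation interval_coordinates "rips_pm p X" K J co by (rule coords)

text \<open>
  At a negative scale there are no simplices, so homology has a single element, whereas a bar
  provides an element different from its double.
\<close>

lemma bars_nonneg:
  assumes "k \<in> K"
  shows "J k \<subseteq> {0..}"
proof (rule ccontr)
  assume "\<not> ?thesis"
  then obtain t where t: "t \<in> J k" "t < 0" by force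
  have "rips_simplices X p t = {}"
  proof (rule equals0I)
    fix \<sigma> assume \<sigma>: "\<sigma> \<in> rips_simplices X p t"
    then have "hd \<sigma> \<in> set \<sigma>" by (intro hd_in_set) (auto simp: rips_simplices_iff)
    then have "dist (hd \<sigma>) (hd \<sigma>) \<le> t" using \<sigma> unfolding rips_simplices_iff by blast
    then show False using t by simp
  qed
  then have "carrier (pspace (rips_pm p X) t) \<subseteq> {rips_class X p t 0}"
    unfolding carrier_rips_pm by (auto simp: rips_cycles_def carrier_rips_chains)
  then have "gen t k \<oplus>\<^bsub>pspace (rips_pm p X) t\<^esub> gen t k = gen t k"
    using gen_closed[OF assms t(1)] add_closed by blast
  then have "co t (gen t k) k = co t (gen t k) k + co t (gen t k) k"
    using co_add[OF gen_closed[OF assms t(1)] gen_closed[OF assms t(1)]] by metis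
  then show False using co_gen[OF assms t(1), of k] by (simp add: bit_add_self)
qed

text \<open>
  The generators of the bars alive at \<open>t\<close> are distinct elements of a finite vector space.
\<close>

lemma finite_bars_at:
  assumes "finite X"
  shows "finite {k \<in> K. t \<in> J k}"
proof (rule inj_on_finite[OF _ _ finite_carrier_rips_pm[OF assms]])
  show "inj_on (gen t) {k \<in> K. t \<in> J k}"
  proof (rule inj_onI)
    fix k l assume kl: "k \<in> {k \<in> K. t \<in> J k}" "l \<in> {k \<in> K. t \<in> J k}" "gen t k = gen t l"
    then have "co t (gen t l) k = 1" using co_gen[of k t k] by simp
    then show "k = l" using kl co_gen[of l t k] by (simp split: if_splits)
  qed
  show "gen t ` {k \<in> K. t \<in> J k} \<subseteq> carrier (pspace (rips_pm p X) t)" using gen_closed by auto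
qed

text \<open>
  The Rips complex changes only at the finitely many distances between points.  Hence a bar alive
  at \<open>t\<close> is also alive at the largest distance \<open>r\<close> not exceeding \<open>t\<close>.
\<close>

lemma bar_contains_distance:
  assumes fin: "finite X" and ne: "X \<noteq> {}" and k: "k \<in> K" "t \<in> J k"
  shows "\<exists>x\<in>X. \<exists>y\<in>X. dist x y \<in> J k"
proof -
  define E where "E = {d. d \<le> t \<and> (\<exists>x\<in>X. \<exists>y\<in>X. d = dist x y)}"
  have "E \<subseteq> (\<lambda>(x, y). dist x y) ` (X \<times> X)" unfolding E_def by auto
  then have finE: "finite E" using fin by (auto intro: finite_subset)
  have "0 \<le> t" using bars_nonneg k by auto
  then have "0 \<in> E" using ne unfolding E_def by force
  define r where "r = Max E"
  have rE: "r \<in> E" unfolding r_def using finE \<open>0 \<in> E\<close> by (intro Max_in) auto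
  have rt: "r \<le> t" using rE by (simp add: E_def)
  have dist_le: "dist x y \<le> r \<longleftrightarrow> dist x y \<le> t" if "x \<in> X" "y \<in> X" for x y
  proof
    assume "dist x y \<le> t"
    then have "dist x y \<in> E" using that unfolding E_def by blast
    then show "dist x y \<le> r" unfolding r_def using finE by simp
  qed (use rt in simp)
  have simplices: "rips_simplices X q r = rips_simplices X q t" for q
    using dist_le by (auto simp: rips_simplices_iff subset_iff)
  then have rips_class: "rips_class X p r = rips_class X p t" and cycles: "rips_cycles X p r = rips_cycles X p t"
    by (auto simp: rips_class_def rips_boundaries_def rips_cycles_def carrier_rips_chains)
  have gen_r: "gen t k \<in> carrier (pspace (rips_pm p X) r)"
    using gen_closed[OF k] unfolding carrier_rips_pm rips_class cycles .
  then obtain c where "gen t k = rips_class X p r c" unfolding carrier_rips_pm by blast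
  then have "pmap (rips_pm p X) t r (gen t k) = gen t k" using pmap_rips_pm[OF rt, of p X c] rips_class by simp
  then have "co r (gen t k) k = 1"
    using co_pmap[OF rt gen_r, of k] co_gen[OF k, of k] k(2) by simp
  then have "r \<in> J k" using co_eq_1D[OF gen_r] by blast
  then show ?thesis using rE unfolding E_def by blast
qed

lemma finite_bars:
  assumes "finite X" "X \<noteq> {}" and "\<And>k. k \<in> K \<Longrightarrow> J k \<noteq> {}"
  shows "finite K"
proof (rule finite_subset)
  show "K \<subseteq> (\<Union>x\<in>X. \<Union>y\<in>X. {k \<in> K. dist x y \<in> J k})"
  proof
    fix k assume k: "k \<in> K"
    then obtain t where "t \<in> J k" using assms(3) by blast
    then obtain x y where "x \<in> X" "y \<in> X" "dist x y \<in> J k"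
      using bar_contains_distance[OF assms(1,2) k] by blast
    then show "k \<in> (\<Union>x\<in>X. \<Union>y\<in>X. {k \<in> K. dist x y \<in> J k})" using k by blast
  qed
  show "finite (\<Union>x\<in>X. \<Union>y\<in>X. {k \<in> K. dist x y \<in> J k})"
    by (intro finite_UN_I assms(1) finite_bars_at)
qed

end

section \<open>The composite map of a model\<close>

text \<open>
  Hausdorff distance \<open>0\<close> puts every point of \<open>Y\<close> in the closure of the image, and a finite
  image is closed.
\<close>

lemma quasi_isometry_0_surj:
  assumes qi: "quasi_isometry L \<epsilon> 0 X Y f" and "finite (f ` X)" "X \<noteq> {}"
  shows "f ` X = Y"
proof
  show "f ` X \<subseteq> Y" using qi by (auto simp: quasi_isometry_def qi_embedding_def)
  show "Y \<subseteq> f ` X"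
  proof
    fix y assume y: "y \<in> Y"
    have "ereal (infdist y (f ` X)) \<le> (SUP y\<in>Y. ereal (infdist y (f ` X)))"
      using y by (rule SUP_upper)
    also have "\<dots> \<le> hausdorff_dist (f ` X) Y" unfolding hausdorff_dist_def by (rule max.cobounded2)
    also have "\<dots> \<le> ereal 0" using qi unfolding quasi_isometry_def by blast
    finally have "infdist y (f ` X) = 0" using infdist_nonneg[of y "f ` X"] by simp
    then show "y \<in> f ` X"
      using assms by (subst in_closed_iff_infdist_zero) (auto intro: finite_imp_closed)
  qed
qed

lemma quasi_isometry_dist:
  assumes "quasi_isometry L \<epsilon> \<delta> X Y f" "x \<in> X" "x' \<in> X" "L > 0"
  shows "dist (f x) (f x') \<le> L * dist x x' + \<epsilon>" "dist x x' \<le> L * (dist (f x) (f x') + \<epsilon>)"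
proof -
  have b: "1 / L * dist x x' - \<epsilon> \<le> dist (f x) (f x')" "dist (f x) (f x') \<le> L * dist x x' + \<epsilon>"
    using assms unfolding quasi_isometry_def qi_embedding_def by blast+
  then show "dist (f x) (f x') \<le> L * dist x x' + \<epsilon>" by blast
  have "dist x x' / L \<le> dist (f x) (f x') + \<epsilon>" using b(1) by simp
  then show "dist x x' \<le> L * (dist (f x) (f x') + \<epsilon>)"
    using \<open>L > 0\<close> by (simp add: pos_divide_le_eq mult.commute)
qed

text \<open>
  Both estimates compare the two ends of the model only through the composite map.  The second
  one bounds the distances between arbitrary preimages, and so the expansion of every section.
\<close>

lemma qi_model_composite:
  assumes L: "L \<ge> 1" and model: "qi_model L \<epsilon>0 \<epsilon>1 \<epsilon>2 Xcont Xnet Yclean Ynoisy f0 f1 f2"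
  defines "F \<equiv> f2 \<circ> f1 \<circ> f0"
  shows "F ` Xcont = Ynoisy" "finite Ynoisy"
    and "\<And>x x'. x \<in> Xcont \<Longrightarrow> x' \<in> Xcont \<Longrightarrow>
      dist (F x) (F x') \<le> L * dist x x' + (L * \<epsilon>0 + \<epsilon>1 + \<epsilon>2)"
    and "\<And>x x'. x \<in> Xcont \<Longrightarrow> x' \<in> Xcont \<Longrightarrow>
      dist x x' \<le> L * dist (F x) (F x') + (L * (\<epsilon>2 + \<epsilon>1) + \<epsilon>0)"
proof -
  have ne: "Xcont \<noteq> {}" "Xnet \<noteq> {}" "Yclean \<noteq> {}" and fin: "finite Xnet"
    and q0: "quasi_isometry 1 \<epsilon>0 0 Xcont Xnet f0"
    and q1: "quasi_isometry L \<epsilon>1 0 Xnet Yclean f1"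
    and q2: "quasi_isometry 1 \<epsilon>2 0 Yclean Ynoisy f2"
    using model unfolding qi_model_def by blast+
  have "f0 ` Xcont \<subseteq> Xnet" using q0 by (auto simp: quasi_isometry_def qi_embedding_def)
  then have s0: "f0 ` Xcont = Xnet" using quasi_isometry_0_surj[OF q0 _ ne(1)] fin finite_subset by blast
  have s1: "f1 ` Xnet = Yclean" using quasi_isometry_0_surj[OF q1 _ ne(2)] fin by blast
  have s2: "f2 ` Yclean = Ynoisy" using quasi_isometry_0_surj[OF q2 _ ne(3)] fin s1 by blast
  show surj: "F ` Xcont = Ynoisy" unfolding F_def image_comp[symmetric] s0 s1 s2 ..
  show "finite Ynoisy" using s1 s2 fin by blast
  fix x x' assume x: "x \<in> Xcont" "x' \<in> Xcont"
  have x0: "f0 x \<in> Xnet" "f0 x' \<in> Xnet" using x s0 by blast+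
  have x1: "f1 (f0 x) \<in> Yclean" "f1 (f0 x') \<in> Yclean" using x0 s1 by blast+
  have "L > 0" using L by simp
  note d0 = quasi_isometry_dist[OF q0 x zero_less_one, simplified]
  note d1 = quasi_isometry_dist[OF q1 x0 \<open>L > 0\<close>]
  note d2 = quasi_isometry_dist[OF q2 x1 zero_less_one, simplified]
  have "L * dist (f0 x) (f0 x') \<le> L * (dist x x' + \<epsilon>0)" using d0(1) \<open>L > 0\<close> by simp
  then show "dist (F x) (F x') \<le> L * dist x x' + (L * \<epsilon>0 + \<epsilon>1 + \<epsilon>2)"
    using d1(1) d2(1) unfolding F_def distrib_left by simp
  have "L * (dist (f1 (f0 x)) (f1 (f0 x')) + \<epsilon>1) \<le> L * (dist (F x) (F x') + \<epsilon>2 + \<epsilon>1)"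
    using d2(2) \<open>L > 0\<close> unfolding F_def by simp
  then show "dist x x' \<le> L * dist (F x) (F x') + (L * (\<epsilon>2 + \<epsilon>1) + \<epsilon>0)"
    using d0(2) d1(2) unfolding distrib_left by linarith
qed

section \<open>The injection of long bars\<close>

lemma theta_eq_aff: "theta L \<epsilon>0 \<epsilon>1 \<epsilon>2 x = aff L (L * (\<epsilon>2 + \<epsilon>1) + \<epsilon>0) x" if "L > 0"
  using that by (cases x) (simp_all add: theta_def aff_def algebra_simps)

lemma aff_phi_inv: "aff L (L * \<epsilon>0 + \<epsilon>1 + \<epsilon>2) (phi_inv L \<epsilon>0 \<epsilon>1 \<epsilon>2 x) = x" if "L > 0"
  using that by (cases x) (simp_all add: phi_inv_def)

lemma phi_inv_le_iff:
  assumes "L > 0"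
  shows "phi_inv L \<epsilon>0 \<epsilon>1 \<epsilon>2 x \<le> y \<longleftrightarrow> x \<le> aff L (L * \<epsilon>0 + \<epsilon>1 + \<epsilon>2) y"
  using aff_le_iff[OF assms, of "L * \<epsilon>0 + \<epsilon>1 + \<epsilon>2" "phi_inv L \<epsilon>0 \<epsilon>1 \<epsilon>2 x" y]
  by (simp only: aff_phi_inv[OF assms])

text \<open>
  The composite \<open>F\<close> of the model is onto and has a section \<open>G\<close>; these induce the two
  morphisms to which \<open>matching\<close> is applied.
\<close>

theorem theorem1p1:
  fixes L \<epsilon>0 \<epsilon>1 \<epsilon>2 :: real and p :: nat
    and Xcont Xnet :: "'a::metric_space set"
    and Yclean :: "'b::metric_space set"
    and Ynoisy :: "'c::metric_space set"
    and f0 :: "'a \<Rightarrow> 'a" and f1 :: "'a \<Rightarrow> 'b" and f2 :: "'b \<Rightarrow> 'c"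
    and DX :: "('l \<times> ereal \<times> ereal) set"
    and DY :: "('k \<times> ereal \<times> ereal) set"
  assumes "L \<ge> 1" and "\<epsilon>0 \<ge> 0" and "\<epsilon>1 \<ge> 0" and "\<epsilon>2 \<ge> 0"
    and "qi_model L \<epsilon>0 \<epsilon>1 \<epsilon>2 Xcont Xnet Yclean Ynoisy f0 f1 f2"
    and "is_dgm (rips_pm p Xcont) DX"
    and "is_dgm (rips_pm p Ynoisy) DY"
  shows "\<exists>box. box \<in> long_part L \<epsilon>0 \<epsilon>1 \<epsilon>2 DY \<rightarrow> DX \<and>
               inj_on box (long_part L \<epsilon>0 \<epsilon>1 \<epsilon>2 DY) \<and>
               (\<forall>k a b l c d.
                  (k, (a, b)) \<in> long_part L \<epsilon>0 \<epsilon>1 \<epsilon>2 DY \<longrightarrow>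
                  box (k, (a, b)) = (l, (c, d)) \<longrightarrow>
                  (c, d) \<in> {phi_inv L \<epsilon>0 \<epsilon>1 \<epsilon>2 a..theta L \<epsilon>0 \<epsilon>1 \<epsilon>2 a} \<times>
                            {phi_inv L \<epsilon>0 \<epsilon>1 \<epsilon>2 b..theta L \<epsilon>0 \<epsilon>1 \<epsilon>2 b})"
proof -
  have "L > 0" using assms(1) by simp
  let ?c = "L * (\<epsilon>2 + \<epsilon>1) + \<epsilon>0" and ?c' = "L * \<epsilon>0 + \<epsilon>1 + \<epsilon>2"
  obtain K' J' where dX: "interval_decomposition (rips_pm p Xcont) K' J'" "DX = dgm K' J'"
    using assms(6) unfolding is_dgm_def by blast
  obtain K J where dY: "interval_decomposition (rips_pm p Ynoisy) K J" "DY = dgm K J"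
    using assms(7) unfolding is_dgm_def by blast
  obtain co' where coX: "interval_coordinates (rips_pm p Xcont) K' J' co'"
    using interval_coordinates_of_decomposition[OF dX(1) rips_pm_add_closed rips_pm_pmap_closed] by blast
  obtain co where coY: "interval_coordinates (rips_pm p Ynoisy) K J co"
    using interval_coordinates_of_decomposition[OF dY(1) rips_pm_add_closed rips_pm_pmap_closed] by blast
  have neJ: "J k \<noteq> {}" if "k \<in> K" for k
    using dY(1) that unfolding interval_decomposition_def by blast
  have neY: "Ynoisy \<noteq> {}" using assms(5) unfolding qi_model_def by blast
  define F where "F = f2 \<circ> f1 \<circ> f0"
  note composite = qi_model_composite[OF assms(1,5), folded F_def]
  define G where "G = inv_into Xcont F"
  have G: "G y \<in> Xcont" "F (G y) = y" if "y \<in> Ynoisy" for y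
    using that unfolding G_def composite(1)[symmetric] by (auto intro: inv_into_into f_inv_into_f)
  have G_dist: "dist (G y) (G y') \<le> L * dist y y' + ?c" if "y \<in> Ynoisy" "y' \<in> Ynoisy" for y y'
    using composite(4)[OF G(1)[OF that(1)] G(1)[OF that(2)]] G(2) that by simp
  have G_maps: "G ` Ynoisy \<subseteq> Xcont" using G(1) by blast
  have F_maps: "F ` Xcont \<subseteq> Ynoisy" using composite(1) by blast
  interpret G: shift_morphism "rips_pm p Ynoisy" K J co "rips_pm p Xcont" K' J' co' L ?c
      "\<lambda>s. induced G Xcont p (L * s + ?c)"
    by (rule shift_morphism_induced[OF coY coX \<open>L > 0\<close> G_maps G_dist])
  interpret F: shift_morphism "rips_pm p Xcont" K' J' co' "rips_pm p Ynoisy" K J co L ?c'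
      "\<lambda>s. induced F Ynoisy p (L * s + ?c')"
    by (rule shift_morphism_induced[OF coX coY \<open>L > 0\<close> F_maps composite(3)])
  have scale: "L * d + c \<le> L * s + c" if "d \<le> s" for d s c
    using that \<open>L > 0\<close> by simp
  interpret interval_retract "rips_pm p Ynoisy" K J co "rips_pm p Xcont" K' J' co' L ?c ?c'
      "\<lambda>s. induced G Xcont p (L * s + ?c)" "\<lambda>s. induced F Ynoisy p (L * s + ?c')"
  proof
    show "1 \<le> L" "0 \<le> ?c" "0 \<le> ?c'" using assms(1-4) by simp_all
    show "finite K" by (rule finite_bars[OF coY composite(2) neY neJ])
    show "J k \<subseteq> {0..}" if "k \<in> K" for k
      using bars_nonneg[OF coY] that by blast
    fix x s assume le: "s \<le> L * (L * s + ?c) + ?c'" and x: "x \<in> carrier (pspace (rips_pm p Ynoisy) s)"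
    then obtain z where z: "z \<in> rips_cycles Ynoisy p s" "x = rips_class Ynoisy p s z"
      unfolding carrier_rips_pm by blast
    have g: "induced G Xcont p (L * s + ?c) x = rips_class Xcont p (L * s + ?c) (push G z)"
      unfolding z(2) by (rule induced_rips_class[OF G_maps]) (meson G_dist scale order_trans)
    have f: "induced F Ynoisy p (L * (L * s + ?c) + ?c') (rips_class Xcont p (L * s + ?c) (push G z))
        = rips_class Ynoisy p (L * (L * s + ?c) + ?c') (push F (push G z))"
      by (rule induced_rips_class[OF F_maps]) (meson composite(3) scale order_trans)
    have "push F (push G z) = z"
      using z(1) G(2)
      by (intro push_push_id[of Ynoisy]) (auto simp: rips_cycles_def carrier_rips_chains rips_simplices_def)
    moreover have "pmap (rips_pm p Ynoisy) (L * (L * s + ?c) + ?c') s x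
        = rips_class Ynoisy p (L * (L * s + ?c) + ?c') z"
      unfolding z(2) by (rule pmap_rips_pm[OF le])
    ultimately show "induced F Ynoisy p (L * (L * s + ?c) + ?c') (induced G Xcont p (L * s + ?c) x)
        = pmap (rips_pm p Ynoisy) (L * (L * s + ?c) + ?c') s x"
      unfolding g f by simp
  qed
  obtain m where inj: "inj_on m long"
    and m: "\<And>k. k \<in> long \<Longrightarrow> m k \<in> K'" "\<And>k. k \<in> long \<Longrightarrow> compatible k (m k)"
    using matching by blast
  have long_iff: "theta L \<epsilon>0 \<epsilon>1 \<epsilon>2 x < phi_inv L \<epsilon>0 \<epsilon>1 \<epsilon>2 y \<longleftrightarrow> aff slope offset x < y" for x y
    using aff_less_iff[OF \<open>L > 0\<close>, of ?c' "theta L \<epsilon>0 \<epsilon>1 \<epsilon>2 x" "phi_inv L \<epsilon>0 \<epsilon>1 \<epsilon>2 y"]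
    unfolding aff_phi_inv[OF \<open>L > 0\<close>] theta_eq_aff[OF \<open>L > 0\<close>] aff_aff by simp
  have long_part: "long_part L \<epsilon>0 \<epsilon>1 \<epsilon>2 DY = (\<lambda>k. (k, (lo (J k), hi (J k)))) ` long"
    unfolding long_part_def dY(2) dgm_def long_def by (auto simp: long_iff)
  define box where "box z = (m (fst z), (lo (J' (m (fst z))), hi (J' (m (fst z)))))"
    for z :: "'k \<times> ereal \<times> ereal"
  have "box \<in> long_part L \<epsilon>0 \<epsilon>1 \<epsilon>2 DY \<rightarrow> DX"
    unfolding long_part dX(2) dgm_def box_def using m(1) by auto
  moreover have "inj_on box (long_part L \<epsilon>0 \<epsilon>1 \<epsilon>2 DY)"
    unfolding long_part box_def using inj by (auto intro!: inj_onI dest: inj_onD)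
  moreover have "(c, d) \<in> {phi_inv L \<epsilon>0 \<epsilon>1 \<epsilon>2 a..theta L \<epsilon>0 \<epsilon>1 \<epsilon>2 a} \<times>
      {phi_inv L \<epsilon>0 \<epsilon>1 \<epsilon>2 b..theta L \<epsilon>0 \<epsilon>1 \<epsilon>2 b}"
    if z: "(k, (a, b)) \<in> long_part L \<epsilon>0 \<epsilon>1 \<epsilon>2 DY" "box (k, (a, b)) = (l, (c, d))" for k a b l c d
  proof -
    have "k \<in> long" "a = lo (J k)" "b = hi (J k)" using z(1) unfolding long_part by auto
    moreover have "c = lo (J' (m k))" "d = hi (J' (m k))" using z(2) by (auto simp: box_def)
    ultimately show ?thesis using m(2)[of k]
      by (simp add: compatible_def theta_eq_aff[OF \<open>L > 0\<close>] phi_inv_le_iff[OF \<open>L > 0\<close>])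
  qed
  ultimately show ?thesis by blast
qed

end
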